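(* Let $p\geq 1$ be a real number, let $k\geq 6$ be an integer, and let $H$ be a $3$-uniform hypergraph that is a Berge-$P_k$, where $P_k$ is the path on $k$ vertices. Then $\lambda^{(p)}(H)\leq\lambda^{(p)}(\Delta_1\ast K_1)$. Furthermore, if $p>2$, then equality holds if and only if $H\cong\Delta_1\ast K_1$.
   Context: All graphs and hypergraphs are finite and simple (no repeated edges); hypergraphs that are Berge-$G$ are taken to have no isolated vertices. An $r$-uniform hypergraph ($r$-graph) has all edges of size $r$. Berge-$G$: for a graph $G$, a hypergraph $H$ is a Berge-$G$ if (after identifying $V(G)$ with a subset of $V(H)$ by an injection) there is a bijection $\phi:E(G)\to E(H)$ with $e\subseteq\phi(e)$ for all $e\in E(G)$. $p$-spectral radius: for an $r$-uniform hypergraph $H$ on vertex set $\{1,\dots,n\}$ and real $p\geq 1$, $\lambda^{(p)}(H):=\max_{\|x\|_p=1} r\sum_{\{i_1,\ldots,i_r\}\in E(H)}x_{i_1}\cdots x_{i_r}$, the maximum over $x\in\mathbb{R}^n$ with $\|x\|_p=(\sum_i|x_i|^p)^{1/p}=1$. Suspension: for a graph $F$, $F\ast K_1$ is the $3$-uniform hypergraph with vertex set $V(F)\cup\{w\}$, $w\notin V(F)$ a new vertex, and edge set $\{e\cup\{w\}:e\in E(F)\}$. $\Delta_1$ is the graph on $k-1$ vertices obtained from a triangle by attaching, at one and the same vertex of the triangle, two pendent paths of lengths $\lfloor (k-4)/2\rfloor$ and $\lceil (k-4)/2\rceil$ (length = number of edges). *)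

theory Defs
  imports "HOL-Analysis.Analysis"
begin

datatype 'a hypergraph = Hypergraph (verts: "'a set") (edges: "'a set set")

text \<open>Finite \<open>r\<close>-uniform hypergraphs; a finite simple graph is the case \<open>r = 2\<close>.\<close>

definition uniform_hypergraph :: "nat \<Rightarrow> 'a hypergraph \<Rightarrow> bool" where
  "uniform_hypergraph r H \<longleftrightarrow>
     finite (verts H) \<and> (\<forall>e\<in>edges H. e \<subseteq> verts H \<and> card e = r)"

definition no_isolated_vertices :: "'a hypergraph \<Rightarrow> bool" where
  "no_isolated_vertices H \<longleftrightarrow> (\<forall>v\<in>verts H. \<exists>e\<in>edges H. v \<in> e)"

definition hypergraph_iso :: "'a hypergraph \<Rightarrow> 'b hypergraph \<Rightarrow> bool" where
  "hypergraph_iso H K \<longleftrightarrow>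
     (\<exists>f. bij_betw f (verts H) (verts K) \<and> (\<lambda>e. f ` e) ` edges H = edges K)"

definition is_berge :: "'b hypergraph \<Rightarrow> 'a hypergraph \<Rightarrow> bool" where
  "is_berge G H \<longleftrightarrow>
     (\<exists>i \<phi>. inj_on i (verts G) \<and> i ` verts G \<subseteq> verts H \<and>
            bij_betw \<phi> (edges G) (edges H) \<and> (\<forall>e\<in>edges G. i ` e \<subseteq> \<phi> e))"

definition p_norm :: "real \<Rightarrow> 'a set \<Rightarrow> ('a \<Rightarrow> real) \<Rightarrow> real" where
  "p_norm p V x = (\<Sum>v\<in>V. \<bar>x v\<bar> powr p) powr (1 / p)"

definition edge_form :: "nat \<Rightarrow> 'a hypergraph \<Rightarrow> ('a \<Rightarrow> real) \<Rightarrow> real" where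
  "edge_form r H x = real r * (\<Sum>e\<in>edges H. \<Prod>v\<in>e. x v)"

text \<open>Vectors indexed by the vertices are functions on the whole type; their values outside
  the vertex set affect neither the norm nor the form. The maximum is attained whenever
  \<open>H\<close> has a vertex: see \<open>p_spectral_radius_attained\<close> below.\<close>

definition p_spectral_radius :: "nat \<Rightarrow> real \<Rightarrow> 'a hypergraph \<Rightarrow> real" where
  "p_spectral_radius r p H =
     (GREATEST y. \<exists>x. p_norm p (verts H) x = 1 \<and> y = edge_form r H x)"

text \<open>The new vertex is \<open>None\<close>.\<close>

definition suspension :: "'a hypergraph \<Rightarrow> 'a option hypergraph" where
  "suspension F =
     Hypergraph (insert None (Some ` verts F)) ((\<lambda>e. insert None (Some ` e)) ` edges F)"

definition walk_edges :: "'a list \<Rightarrow> 'a set set" where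
  "walk_edges xs = {{xs ! i, xs ! Suc i} | i. Suc i < length xs}"

definition path_graph :: "nat \<Rightarrow> nat hypergraph" where
  "path_graph k = Hypergraph {..<k} (walk_edges [0..<k])"

text \<open>The triangle on \<open>0, 1, 2\<close> with pendent paths \<open>0, 3, \<dots>, a + 2\<close> (of length \<open>a\<close>) and
  \<open>0, a + 3, \<dots>, a + b + 2\<close> (of length \<open>b\<close>) attached at \<open>0\<close>.\<close>

definition triangle_two_paths :: "nat \<Rightarrow> nat \<Rightarrow> nat hypergraph" where
  "triangle_two_paths a b =
     Hypergraph {..<a + b + 3}
       ({{0, 1}, {1, 2}, {0, 2}}
        \<union> walk_edges (0 # [3..<a + 3]) \<union> walk_edges (0 # [a + 3..<a + b + 3]))"

definition Delta1 :: "nat \<Rightarrow> nat hypergraph" where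
  "Delta1 k = triangle_two_paths (nat \<lfloor>(real k - 4) / 2\<rfloor>) (nat \<lceil>(real k - 4) / 2\<rceil>)"

lemma walk_edges_Cons_Cons: "walk_edges (x # y # xs) = insert {x, y} (walk_edges (y # xs))"
proof -
  have "walk_edges (x # y # xs) =
      (\<lambda>i. {(x # y # xs) ! i, (x # y # xs) ! Suc i}) ` {..<Suc (length xs)}"
    by (auto simp: walk_edges_def)
  also have "\<dots> = insert {x, y} ((\<lambda>i. {(y # xs) ! i, (y # xs) ! Suc i}) ` {..<length xs})"
    unfolding lessThan_Suc_eq_insert_0 by (simp add: image_image)
  also have "\<dots> = insert {x, y} (walk_edges (y # xs))"
    by (auto simp: walk_edges_def)
  finally show ?thesis .
qed

lemma walk_edges_2_uniform:
  assumes "distinct xs" "e \<in> walk_edges xs"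
  shows "e \<subseteq> set xs \<and> card e = 2"
  using assms by (auto simp: walk_edges_def nth_eq_iff_index_eq)

lemma path_graph_uniform: "uniform_hypergraph 2 (path_graph k)"
  using walk_edges_2_uniform[of "[0..<k]"]
  by (fastforce simp: uniform_hypergraph_def path_graph_def)

lemma Delta1_uniform: "uniform_hypergraph 2 (Delta1 k)"
proof -
  have "uniform_hypergraph 2 (triangle_two_paths a b)" for a b
    using walk_edges_2_uniform[of "0 # [3..<a + 3]"]
      walk_edges_2_uniform[of "0 # [a + 3..<a + b + 3]"]
    by (fastforce simp: uniform_hypergraph_def triangle_two_paths_def)
  then show ?thesis by (simp add: Delta1_def)
qed

lemma Delta1_div:
  assumes "k \<ge> 4"
  shows "Delta1 k = triangle_two_paths ((k - 4) div 2) ((k - 3) div 2)"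
proof -
  define n where "n = k - 4"
  have n: "real k - 4 = real n" "k - 3 = Suc n" using assms by (auto simp: n_def)
  have "nat \<lfloor>real n / 2\<rfloor> = n div 2 \<and> nat \<lceil>real n / 2\<rceil> = Suc n div 2"
  proof (cases "even n")
    case True
    then obtain m where "n = 2 * m" by (elim evenE)
    then show ?thesis by simp
  next
    case False
    then obtain m where m: "n = 2 * m + 1" by (elim oddE)
    then have "\<lfloor>real n / 2\<rfloor> = int m" "\<lceil>real n / 2\<rceil> = int m + 1" by linarith+
    then show ?thesis using m by simp
  qed
  then show ?thesis unfolding Delta1_def n by (simp add: n_def)
qed

lemma card_verts_Delta1:
  assumes "k \<ge> 4"
  shows "card (verts (Delta1 k)) = k - 1"
proof -
  have "(k - 4) div 2 + (k - 3) div 2 + 3 = k - 1" using assms by linarith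
  then show ?thesis by (simp add: Delta1_div[OF assms] triangle_two_paths_def)
qed

lemma suspension_uniform:
  assumes "uniform_hypergraph 2 F"
  shows "uniform_hypergraph 3 (suspension F)"
proof -
  have "card (insert None (Some ` e)) = 3" if "e \<in> edges F" for e
  proof -
    have "card e = 2" using assms that by (auto simp: uniform_hypergraph_def)
    then have "finite e" by (metis card.infinite zero_neq_numeral)
    with \<open>card e = 2\<close> show ?thesis by (simp add: card_image)
  qed
  then show ?thesis
    using assms by (auto simp: uniform_hypergraph_def suspension_def)
qed

lemma p_norm_eq_1_iff:
  assumes "p \<ge> 1"
  shows "p_norm p V x = 1 \<longleftrightarrow> (\<Sum>v\<in>V. \<bar>x v\<bar> powr p) = 1"
proof -
  define s where "s = (\<Sum>v\<in>V. \<bar>x v\<bar> powr p)"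
  have "0 \<le> s" by (simp add: s_def sum_nonneg)
  then have "s = (s powr (1 / p)) powr p" using assms by (simp add: powr_powr)
  then have "s powr (1 / p) = 1 \<longleftrightarrow> s = 1" by (metis powr_one_eq_one)
  then show ?thesis by (simp add: p_norm_def s_def)
qed

lemma p_spectral_radius_attained:
  assumes H: "uniform_hypergraph r H" and ne: "verts H \<noteq> {}" and p: "p \<ge> 1"
  shows "\<exists>x. p_norm p (verts H) x = 1 \<and> edge_form r H x = p_spectral_radius r p H"
    and "p_norm p (verts H) x = 1 \<Longrightarrow> edge_form r H x \<le> p_spectral_radius r p H"
proof -
  define V where "V = verts H"
  have fin: "finite V" and sub: "\<And>e. e \<in> edges H \<Longrightarrow> e \<subseteq> V"
    using H by (auto simp: uniform_hypergraph_def V_def)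
  define B :: "('a \<Rightarrow> real) set" where "B = PiE UNIV (\<lambda>v. if v \<in> V then {-1..1} else {0})"
  define S where "S = {x \<in> B. (\<Sum>v\<in>V. \<bar>x v\<bar> powr p) = 1}"
  have "compactin (product_topology (\<lambda>_. euclidean) UNIV) B"
    unfolding B_def compactin_PiE by auto
  then have "compact B" by (simp add: euclidean_product_topology)
  moreover have "closed {x :: 'a \<Rightarrow> real. (\<Sum>v\<in>V. \<bar>x v\<bar> powr p) = 1}"
    by (intro closed_Collect_eq continuous_on_sum continuous_on_powr' continuous_on_rabs
        continuous_on_product_coordinates continuous_on_const) (use p in auto)
  ultimately have "compact S"
    unfolding S_def Collect_conj_eq Collect_mem_eq by (rule compact_Int_closed)
  moreover obtain u where "u \<in> V" using ne by (auto simp: V_def)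
  then have "(\<lambda>v. if v = u then 1 else 0) \<in> S"
    using fin by (auto simp: S_def B_def if_distrib[of abs] if_distrib[of "\<lambda>t. t powr p"] cong: if_cong)
  then have "S \<noteq> {}" by blast
  moreover have "continuous_on S (edge_form r H)"
    unfolding edge_form_def
    by (intro continuous_intros continuous_on_subset[OF continuous_on_product_coordinates]) auto
  ultimately have "\<exists>m\<in>S. \<forall>x\<in>S. edge_form r H x \<le> edge_form r H m"
    by (rule continuous_attains_sup)
  then obtain m where m: "m \<in> S" "\<And>x. x \<in> S \<Longrightarrow> edge_form r H x \<le> edge_form r H m"
    by blast
  have le: "edge_form r H x \<le> edge_form r H m" if x: "p_norm p V x = 1" for x
  proof -
    define x' where "x' = (\<lambda>v. if v \<in> V then x v else 0)"
    have sum: "(\<Sum>v\<in>V. \<bar>x v\<bar> powr p) = 1" using x p_norm_eq_1_iff[OF p] by metis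
    have "\<bar>x v\<bar> \<le> 1" if "v \<in> V" for v
    proof (rule ccontr)
      assume "\<not> \<bar>x v\<bar> \<le> 1"
      then have "1 < \<bar>x v\<bar> powr p" using p by (intro gr_one_powr) auto
      also have "\<dots> \<le> (\<Sum>v\<in>V. \<bar>x v\<bar> powr p)" using fin that by (intro member_le_sum) auto
      finally show False using sum by simp
    qed
    then have "x' \<in> S" using sum by (auto simp: S_def B_def x'_def abs_le_iff minus_le_iff)
    moreover have "edge_form r H x' = edge_form r H x"
      unfolding edge_form_def x'_def
      by (intro arg_cong2[where f = "(*)"] sum.cong prod.cong refl) (use sub in auto)
    ultimately show ?thesis using m(2)[of x'] by simp
  qed
  have mn: "p_norm p V m = 1" using m(1) by (simp add: S_def p_norm_eq_1_iff[OF p])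
  have eq: "p_spectral_radius r p H = edge_form r H m"
    unfolding p_spectral_radius_def V_def[symmetric]
    by (rule Greatest_equality) (use mn le in auto)
  show "\<exists>x. p_norm p (verts H) x = 1 \<and> edge_form r H x = p_spectral_radius r p H"
    using mn eq by (auto simp: V_def)
  show "p_norm p (verts H) x = 1 \<Longrightarrow> edge_form r H x \<le> p_spectral_radius r p H"
    using le eq by (simp add: V_def)
qed

end

theory Submission
  imports Defs
begin

text \<open>Let \<open>x\<close> be a nonnegative maximizer for a Berge path \<open>H\<close> with \<open>k - 1\<close> edges. Number the vertices by
  ranks \<open>0, 1, 2, \<dots>\<close> in order of decreasing weight and let \<open>z m\<close> be the weight at rank \<open>m\<close>. In every
  edge replace the heaviest vertex by the vertex of rank \<open>0\<close>; this can only increase the form,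
  which becomes \<open>z 0\<close> times a sum of products \<open>z (mid i) * z (hi i)\<close> over pairs of ranks. Writing \<open>z\<close>
  as a nonnegative combination of indicators of initial segments of ranks turns the sum over pairs
  into a nonnegative combination of the numbers obtained by counting, for initial segments
  \<open>X \<subseteq> Y\<close>, each edge \<open>e \<subseteq> Y\<close> with multiplicity \<open>card (e \<inter> X) - 1\<close>.

  These counts have simple upper bounds, valid for all sets of vertices \<open>X \<subseteq> Y\<close>. Fewer than
  \<open>card X\<close> edges of a Berge path lie inside \<open>X\<close>, since each of them uses up a step of the path inside
  \<open>X\<close>; and the total multiplicity is at most \<open>2 * card X\<close>, since a path vertex is on at most two steps.
  Together with two small cases these bounds are attained simultaneously by the suspension of
  \<open>Delta1 k\<close>, for all initial segments at once, when its vertices are ranked as follows: the apex \<open>0\<close>,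
  the centre \<open>1\<close>, the other triangle vertices \<open>2\<close> and \<open>3\<close>, and then alternately the next vertices of the
  two arms (\<open>excess_le_Delta_count\<close>). Transplanting \<open>z\<close> to this ranked copy, \<open>ranked_Delta k\<close>, therefore
  proves the inequality, the vertices of rank \<open>\<ge> k\<close> being dropped.

  Suppose that equality holds. Then \<open>z\<close>, read on \<open>ranked_Delta k\<close>, is a maximizer there. As \<open>p > 1\<close>,
  its coordinates of rank below \<open>k\<close> are positive, and two equal coordinates must have equal partial
  derivatives; comparing neighbourhoods shows that \<open>z\<close> drops strictly after the initial segments of
  sizes \<open>1\<close>, \<open>2\<close>, of every even size from \<open>4\<close> on, and of size \<open>k\<close> (\<open>Delta_maximizer.gap\<close>). At these sizes
  the counts for \<open>H\<close> agree with those of \<open>ranked_Delta k\<close>, and all edges of \<open>H\<close> contain rank \<open>0\<close>. Ties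
  between ranks \<open>2 * m\<close> and \<open>2 * m + 1\<close> may remain, but equality at even sizes says that for \<open>m \<ge> 3\<close>
  such a pair is joined to the preceding pair by exactly two edges, and the general bounds above, applied to sets
  that are not initial segments, make these two edges a matching. Hence \<open>H\<close> is a triangle with two
  balanced arms, suspended (\<open>extremal_pairs.ranked_Delta_iso\<close>).\<close>

section \<open>Isomorphic hypergraphs and bounds on the spectral radius\<close>

lemma sum_prod_edges_image:
  fixes y :: "'b \<Rightarrow> real"
  assumes f: "inj_on f V" and E: "\<And>e. e \<in> E \<Longrightarrow> e \<subseteq> V"
  shows "(\<Sum>e\<in>(\<lambda>e. f ` e) ` E. \<Prod>w\<in>e. y w) = (\<Sum>e\<in>E. \<Prod>v\<in>e. y (f v))"
proof -
  have "inj_on (\<lambda>e. f ` e) E"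
    using inj_on_image_eq_iff[OF f] E by (simp add: inj_on_def)
  moreover have "inj_on f e" if "e \<in> E" for e using inj_on_subset[OF f E[OF that]] .
  ultimately show ?thesis by (simp add: sum.reindex prod.reindex)
qed

lemma hypergraph_iso_sym:
  assumes iso: "hypergraph_iso H K" and H: "\<And>e. e \<in> edges H \<Longrightarrow> e \<subseteq> verts H"
  shows "hypergraph_iso K H"
proof -
  obtain f where f: "bij_betw f (verts H) (verts K)" "(\<lambda>e. f ` e) ` edges H = edges K"
    using iso by (auto simp: hypergraph_iso_def)
  define g where "g = inv_into (verts H) f"
  have "g ` f ` e = e" if "e \<in> edges H" for e
    using H[OF that] inv_into_image_cancel[OF bij_betw_imp_inj_on[OF f(1)]] by (simp add: g_def)
  then have "(\<lambda>e. g ` e) ` edges K = edges H"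
    unfolding f(2)[symmetric] by (force simp: image_iff)
  moreover have "bij_betw g (verts K) (verts H)"
    unfolding g_def by (rule bij_betw_inv_into[OF f(1)])
  ultimately show ?thesis by (auto simp: hypergraph_iso_def)
qed

lemma hypergraph_iso_trans:
  assumes "hypergraph_iso H K" "hypergraph_iso K L"
  shows "hypergraph_iso H L"
proof -
  obtain f where f: "bij_betw f (verts H) (verts K)" "(\<lambda>e. f ` e) ` edges H = edges K"
    using assms(1) by (auto simp: hypergraph_iso_def)
  obtain g where g: "bij_betw g (verts K) (verts L)" "(\<lambda>e. g ` e) ` edges K = edges L"
    using assms(2) by (auto simp: hypergraph_iso_def)
  have "bij_betw (g \<circ> f) (verts H) (verts L)" by (rule bij_betw_trans[OF f(1) g(1)])
  moreover have "(\<lambda>e. (g \<circ> f) ` e) ` edges H = edges L"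
    unfolding g(2)[symmetric] f(2)[symmetric] by (simp add: image_image image_comp)
  ultimately show ?thesis unfolding hypergraph_iso_def by blast
qed

lemma p_spectral_radius_iso:
  assumes iso: "hypergraph_iso H K" and H: "\<And>e. e \<in> edges H \<Longrightarrow> e \<subseteq> verts H"
  shows "p_spectral_radius r p H = p_spectral_radius r p K"
proof -
  obtain f where f: "bij_betw f (verts H) (verts K)" and fE: "(\<lambda>e. f ` e) ` edges H = edges K"
    using iso by (auto simp: hypergraph_iso_def)
  have inj: "inj_on f (verts H)" using f by (rule bij_betw_imp_inj_on)
  have norm: "p_norm p (verts K) x = p_norm p (verts H) (x \<circ> f)" for x
    using sum.reindex_bij_betw[OF f, of "\<lambda>v. \<bar>x v\<bar> powr p"] by (simp add: p_norm_def)
  have form: "edge_form r K x = edge_form r H (x \<circ> f)" for x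
    using sum_prod_edges_image[OF inj H, of "edges H" x] fE by (simp add: edge_form_def)
  define g where "g = inv_into (verts H) f"
  have gf: "g (f v) = v" if "v \<in> verts H" for v
    unfolding g_def using inj that by (rule inv_into_f_f)
  have "p_norm p (verts H) (x \<circ> g \<circ> f) = p_norm p (verts H) x" for x
    unfolding p_norm_def using gf by (intro arg_cong2[where f = "(powr)"] sum.cong) auto
  moreover have "edge_form r H (x \<circ> g \<circ> f) = edge_form r H x" for x
    unfolding edge_form_def using gf H
    by (intro arg_cong2[where f = "(*)"] sum.cong prod.cong) (auto simp: subset_iff)
  ultimately have "(\<exists>x. p_norm p (verts H) x = 1 \<and> y = edge_form r H x) \<longleftrightarrow>
      (\<exists>x. p_norm p (verts K) x = 1 \<and> y = edge_form r K x)" for y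
    unfolding norm form by metis
  then show ?thesis by (simp add: p_spectral_radius_def)
qed

text \<open>Replacing every coordinate by its absolute value preserves the norm and does not decrease the form.\<close>

lemma nonneg_maximizer:
  assumes H: "uniform_hypergraph r H" and ne: "verts H \<noteq> {}" and p: "p \<ge> 1"
  obtains x where "\<And>v. x v \<ge> 0" "(\<Sum>v\<in>verts H. x v powr p) = 1"
    "edge_form r H x = p_spectral_radius r p H"
proof -
  obtain x where x: "p_norm p (verts H) x = 1" "edge_form r H x = p_spectral_radius r p H"
    using p_spectral_radius_attained(1)[OF H ne p] by blast
  define y where "y v = \<bar>x v\<bar>" for v
  have y: "p_norm p (verts H) y = 1" using x(1) by (simp add: p_norm_def y_def)
  have "edge_form r H x \<le> edge_form r H y"
    unfolding edge_form_def y_def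
    by (intro mult_left_mono sum_mono) (simp_all flip: abs_prod)
  then have "edge_form r H y = p_spectral_radius r p H"
    using p_spectral_radius_attained(2)[OF H ne p y] x(2) by simp
  moreover have "(\<Sum>v\<in>verts H. y v powr p) = 1"
    using y by (simp add: p_norm_eq_1_iff[OF p] y_def)
  ultimately show ?thesis using that[of y] by (simp add: y_def)
qed

lemma p_spectral_radius_nonneg:
  assumes "uniform_hypergraph r H" and "verts H \<noteq> {}" and "p \<ge> 1"
  shows "p_spectral_radius r p H \<ge> 0"
proof -
  obtain x where "\<And>v. x v \<ge> 0" "edge_form r H x = p_spectral_radius r p H"
    using nonneg_maximizer[OF assms] by metis
  then show ?thesis
    by (metis edge_form_def of_nat_0_le_iff mult_nonneg_nonneg sum_nonneg prod_nonneg)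
qed

text \<open>The form is homogeneous of degree \<open>r\<close>, so the bound on the unit sphere extends to all vectors.\<close>

lemma edge_form_le_scaled:
  assumes H: "uniform_hypergraph r H" and r: "r > 0" and p: "p \<ge> 1"
  shows "edge_form r H y \<le>
    p_spectral_radius r p H * ((\<Sum>v\<in>verts H. \<bar>y v\<bar> powr p) powr (1 / p)) ^ r"
proof -
  have fin: "finite (verts H)" and E: "\<And>e. e \<in> edges H \<Longrightarrow> e \<subseteq> verts H \<and> card e = r"
    using H by (auto simp: uniform_hypergraph_def)
  define s where "s = (\<Sum>v\<in>verts H. \<bar>y v\<bar> powr p)"
  define N where "N = s powr (1 / p)"
  have s: "s \<ge> 0" by (simp add: s_def sum_nonneg)
  show ?thesis
  proof (cases "s = 0")
    case True
    then have "y v = 0" if "v \<in> verts H" for v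
      using that fin by (simp add: s_def sum_nonneg_eq_0_iff)
    then have "(\<Prod>v\<in>e. y v) = 0" if e: "e \<in> edges H" for e
    proof -
      obtain v where "v \<in> e" using E[OF e] r by fastforce
      moreover have "finite e" using E[OF e] fin finite_subset by blast
      ultimately show ?thesis using E[OF e] \<open>\<And>v. v \<in> verts H \<Longrightarrow> y v = 0\<close>
        by (intro prod_zero) auto
    qed
    then show ?thesis using True r by (simp add: edge_form_def s_def power_0_left)
  next
    case False
    then have N: "N > 0" using s by (simp add: N_def)
    have Np: "N powr p = s" using s p by (simp add: N_def powr_powr)
    have ne: "verts H \<noteq> {}" using False by (auto simp: s_def)
    have "p_norm p (verts H) (\<lambda>v. y v / N) = 1"
      using N Np False
      by (simp add: p_norm_eq_1_iff[OF p] powr_divide sum_divide_distrib[symmetric] flip: s_def)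
    then have "edge_form r H (\<lambda>v. y v / N) \<le> p_spectral_radius r p H"
      by (rule p_spectral_radius_attained(2)[OF H ne p])
    also have "edge_form r H (\<lambda>v. y v / N) = edge_form r H y / N ^ r"
      unfolding edge_form_def using E by (simp add: prod_dividef flip: sum_divide_distrib)
    finally show ?thesis using N by (simp add: field_simps flip: s_def N_def)
  qed
qed

lemma edge_form_le_p_spectral_radius:
  assumes H: "uniform_hypergraph r H" and ne: "verts H \<noteq> {}" and r: "r > 0" and p: "p \<ge> 1"
    and y: "(\<Sum>v\<in>verts H. \<bar>y v\<bar> powr p) \<le> 1"
  shows "edge_form r H y \<le> p_spectral_radius r p H"
proof -
  have "((\<Sum>v\<in>verts H. \<bar>y v\<bar> powr p) powr (1 / p)) ^ r \<le> 1"
  proof (rule power_le_one)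
    show "(\<Sum>v\<in>verts H. \<bar>y v\<bar> powr p) powr (1 / p) \<le> 1"
      using p y by (intro powr_le1) (simp_all add: sum_nonneg abs_of_nonneg)
  qed simp
  from order_trans[OF edge_form_le_scaled[OF H r p] mult_left_le[OF this p_spectral_radius_nonneg[OF H ne p]]]
  show ?thesis .
qed

lemma decreasing_enumeration:
  fixes x :: "'a \<Rightarrow> real"
  assumes "finite V"
  obtains \<tau> where "bij_betw \<tau> {..<card V} V"
    "\<And>i j. i \<le> j \<Longrightarrow> j < card V \<Longrightarrow> x (\<tau> j) \<le> x (\<tau> i)"
proof -
  obtain xs where xs: "set xs = V" "distinct xs" using finite_distinct_list[OF assms] by blast
  define ys where "ys = sort_key (\<lambda>v. - x v) xs"
  have ys: "set ys = V" "distinct ys" "sorted (map (\<lambda>v. - x v) ys)"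
    using xs by (simp_all add: ys_def)
  then have len: "length ys = card V" using distinct_card by metis
  have "bij_betw (\<lambda>i. ys ! i) {..<card V} V"
    by (rule bij_betw_nth[OF ys(2)]) (simp_all add: len ys(1))
  moreover have "x (ys ! j) \<le> x (ys ! i)" if "i \<le> j" "j < card V" for i j
    using sorted_nth_mono[OF ys(3) that(1)] that len by simp
  ultimately show ?thesis using that by blast
qed

text \<open>The coordinates of a nonnegative maximizer, listed in decreasing order and continued by \<open>0\<close>; \<open>\<rho>\<close>
  assigns to each vertex its rank.\<close>

lemma ranked_maximizer:
  assumes H: "uniform_hypergraph r H" and ne: "verts H \<noteq> {}" and p: "p \<ge> 1"
  obtains \<rho> and z :: "nat \<Rightarrow> real" where "bij_betw \<rho> (verts H) {..<card (verts H)}"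
    "decseq z" "\<And>m. z m \<ge> 0" "\<And>m. m \<ge> card (verts H) \<Longrightarrow> z m = 0"
    "(\<Sum>m<card (verts H). z m powr p) = 1" "edge_form r H (z \<circ> \<rho>) = p_spectral_radius r p H"
proof -
  define n where "n = card (verts H)"
  have fin: "finite (verts H)" using H by (simp add: uniform_hypergraph_def)
  obtain x where x: "\<And>v. x v \<ge> 0" "(\<Sum>v\<in>verts H. x v powr p) = 1"
    "edge_form r H x = p_spectral_radius r p H"
    using nonneg_maximizer[OF H ne p] by metis
  obtain \<tau> where \<tau>: "bij_betw \<tau> {..<n} (verts H)"
    "\<And>i j. i \<le> j \<Longrightarrow> j < n \<Longrightarrow> x (\<tau> j) \<le> x (\<tau> i)"
    using decreasing_enumeration[OF fin, of x] unfolding n_def by metis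
  define z where "z m = (if m < n then x (\<tau> m) else 0)" for m
  define \<rho> where "\<rho> = inv_into {..<n} \<tau>"
  have \<rho>: "bij_betw \<rho> (verts H) {..<n}" unfolding \<rho>_def by (rule bij_betw_inv_into[OF \<tau>(1)])
  have z\<rho>: "z (\<rho> v) = x v" if "v \<in> verts H" for v
    using that bij_betw_apply[OF \<rho> that] bij_betw_inv_into_right[OF \<tau>(1)]
    by (simp add: z_def \<rho>_def)
  have "edge_form r H (z \<circ> \<rho>) = edge_form r H x"
    unfolding edge_form_def using z\<rho> H
    by (intro arg_cong2[where f = "(*)"] sum.cong prod.cong)
      (auto simp: uniform_hypergraph_def subset_iff)
  moreover have "decseq z"
    by (intro decseq_SucI) (use \<tau>(2) x(1) in \<open>auto simp: z_def\<close>)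
  moreover have "(\<Sum>m<n. z m powr p) = 1"
    using sum.reindex_bij_betw[OF \<tau>(1), of "\<lambda>v. x v powr p"] x(2) by (simp add: z_def)
  ultimately show ?thesis
    using that[of \<rho> z] \<rho> x by (simp add: n_def z_def)
qed

section \<open>Berge paths\<close>

text \<open>The edge \<open>e i\<close> of a Berge path on \<open>k\<close> vertices carries the step from \<open>v i\<close> to \<open>v (Suc i)\<close>, for \<open>i < k - 1\<close>.\<close>

definition berge_path :: "nat \<Rightarrow> (nat \<Rightarrow> 'a) \<Rightarrow> (nat \<Rightarrow> 'a set) \<Rightarrow> bool" where
  "berge_path k v e \<longleftrightarrow> inj_on v {..<k} \<and> inj_on e {..<k - 1} \<and>
     (\<forall>i<k - 1. card (e i) = 3 \<and> v i \<in> e i \<and> v (Suc i) \<in> e i)"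

lemma berge_pathD:
  assumes "berge_path k v e"
  shows "inj_on v {..<k}" "inj_on e {..<k - 1}"
    "\<And>i. i < k - 1 \<Longrightarrow> card (e i) = 3" "\<And>i. i < k - 1 \<Longrightarrow> finite (e i)"
    "\<And>i. i < k - 1 \<Longrightarrow> v i \<in> e i" "\<And>i. i < k - 1 \<Longrightarrow> v (Suc i) \<in> e i"
  using assms by (auto simp: berge_path_def intro: card_ge_0_finite)

lemma berge_path_image:
  assumes B: "berge_path k v e" and f: "inj_on f W" and W: "\<And>i. i < k - 1 \<Longrightarrow> e i \<subseteq> W"
    and k: "k \<ge> 2"
  shows "berge_path k (f \<circ> v) (\<lambda>i. f ` e i)"
proof -
  have vW: "v i \<in> W" if "i < k" for i
  proof (cases "i < k - 1")
    case True then show ?thesis using berge_pathD(5)[OF B] W by blast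
  next
    case False
    then have "i = Suc (k - 2)" "k - 2 < k - 1" using that k by auto
    then show ?thesis using berge_pathD(6)[OF B, of "k - 2"] W[of "k - 2"] by auto
  qed
  have "inj_on (f \<circ> v) {..<k}"
    by (intro comp_inj_on berge_pathD(1)[OF B] inj_on_subset[OF f]) (use vW in auto)
  moreover have "inj_on (\<lambda>i. f ` e i) {..<k - 1}"
    using berge_pathD(2)[OF B] inj_on_image_eq_iff[OF f] W by (simp add: inj_on_def)
  moreover have "card (f ` e i) = 3" if "i < k - 1" for i
    using card_image[OF inj_on_subset[OF f W[OF that]]] berge_pathD(3)[OF B that] by simp
  ultimately show ?thesis
    using berge_pathD(5,6)[OF B] by (auto simp: berge_path_def)
qed

lemma is_berge_path_graph:
  assumes "is_berge (path_graph k) H" and "uniform_hypergraph 3 H"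
  obtains v e where "berge_path k v e" "edges H = e ` {..<k - 1}" "v ` {..<k} \<subseteq> verts H"
proof -
  have walk: "edges (path_graph k) = (\<lambda>i. {i, Suc i}) ` {..<k - 1}"
  proof -
    have "walk_edges [0..<k] = {{i, Suc i} | i. Suc i < k}"
      unfolding walk_edges_def by (intro Collect_cong ex_cong1) auto
    then show ?thesis by (auto simp: path_graph_def)
  qed
  obtain v \<phi> where v: "inj_on v {..<k}" "v ` {..<k} \<subseteq> verts H"
    and \<phi>: "bij_betw \<phi> (edges (path_graph k)) (edges H)"
      "\<forall>f\<in>edges (path_graph k). v ` f \<subseteq> \<phi> f"
    using assms(1) by (auto simp: is_berge_def path_graph_def)
  define e where "e i = \<phi> {i, Suc i}" for i
  have "inj_on (\<lambda>i. {i, Suc i}) {..<k - 1}"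
    by (auto simp: inj_on_def doubleton_eq_iff)
  then have "inj_on e {..<k - 1}"
    using comp_inj_on[of "\<lambda>i. {i, Suc i}" "{..<k - 1}" \<phi>] bij_betw_imp_inj_on[OF \<phi>(1)]
    unfolding walk e_def by (simp add: o_def)
  moreover have E: "edges H = e ` {..<k - 1}"
    using bij_betw_imp_surj_on[OF \<phi>(1)] unfolding walk e_def by (simp add: image_image)
  moreover have "card (e i) = 3" if "i < k - 1" for i
    using assms(2) E that by (auto simp: uniform_hypergraph_def)
  moreover have "v i \<in> e i \<and> v (Suc i) \<in> e i" if "i < k - 1" for i
    using \<phi>(2) that by (auto simp: walk e_def)
  ultimately show ?thesis using that[of v e] v by (auto simp: berge_path_def)
qed

section \<open>Counting the edges of a Berge path near a set of vertices\<close>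

text \<open>An edge that meets \<open>X\<close> in \<open>j > 0\<close> vertices has multiplicity \<open>j - 1\<close>: its heaviest vertex, which lies in \<open>X\<close>
  whenever \<open>X\<close> consists of the heaviest vertices, is discounted. Truncated subtraction makes edges
  that miss \<open>X\<close> contribute nothing.\<close>

definition excess :: "nat \<Rightarrow> (nat \<Rightarrow> 'a set) \<Rightarrow> 'a set \<Rightarrow> 'a set \<Rightarrow> nat" where
  "excess k e X Y = (\<Sum>i | i < k - 1 \<and> e i \<subseteq> Y. card (e i \<inter> X) - 1)"

text \<open>Each edge inside \<open>X\<close> has the end \<open>v (Suc i)\<close> of its step in \<open>X\<close>, and the start of the first such step
  is one more vertex of \<open>X\<close>.\<close>

lemma card_edges_within_less:
  assumes B: "berge_path k v e" and X: "finite X" "X \<noteq> {}"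
  shows "card {i. i < k - 1 \<and> e i \<subseteq> X} < card X"
proof (cases "{i. i < k - 1 \<and> e i \<subseteq> X} = {}")
  case True
  then show ?thesis using X by (simp only: card.empty card_gt_0_iff) simp
next
  case False
  define I where "I = {i. i < k - 1 \<and> e i \<subseteq> X}"
  have I: "finite I" "I \<noteq> {}" using False by (auto simp: I_def)
  define m where "m = Min I"
  have m: "m \<in> I" "\<And>i. i \<in> I \<Longrightarrow> m \<le> i" using I by (auto simp: m_def)
  have sub: "insert m (Suc ` I) \<subseteq> {..<k}" using m by (auto simp: I_def)
  have "card (v ` insert m (Suc ` I)) = card (insert m (Suc ` I))"
    by (intro card_image inj_on_subset[OF berge_pathD(1)[OF B] sub])
  also have "\<dots> = Suc (card I)"
    using I m(2) by (subst card_insert_disjoint) (force simp: card_image)+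
  finally have "Suc (card I) = card (v ` insert m (Suc ` I))" by simp
  also have "\<dots> \<le> card X"
    using berge_pathD(5,6)[OF B] m(1) by (intro card_mono X) (auto simp: I_def)
  finally show ?thesis by (simp add: I_def)
qed

lemma card_edges_within_3:
  assumes B: "berge_path k v e" and X: "card X = 3"
  shows "card {i. i < k - 1 \<and> e i \<subseteq> X} \<le> 1"
proof -
  have fin: "finite X" using X by (intro card_ge_0_finite) simp
  have "e i = X" if "i < k - 1" "e i \<subseteq> X" for i
    using card_subset_eq[OF fin that(2)] berge_pathD(3)[OF B that(1)] X by simp
  then have "i = j" if "i < k - 1" "e i \<subseteq> X" "j < k - 1" "e j \<subseteq> X" for i j
    using inj_onD[OF berge_pathD(2)[OF B], of i j] that by (metis lessThan_iff)
  then show ?thesis by (simp add: card_le_Suc0_iff_eq)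
qed

text \<open>An edge has just one vertex besides the two ends of its step, so its multiplicity is at most the
  number of ends of the step that lie in \<open>X\<close>, and a path vertex is an end of at most two steps.\<close>

lemma excess_le_double:
  assumes B: "berge_path k v e" and X: "finite X"
  shows "excess k e X Y \<le> 2 * card X"
proof -
  have hit: "(\<Sum>i<k - 1. of_bool (v (f i) \<in> X)) \<le> card X"
    if f: "inj_on f {..<k - 1}" "f ` {..<k - 1} \<subseteq> {..<k}" for f :: "nat \<Rightarrow> nat"
  proof -
    define I where "I = {i. i < k - 1 \<and> v (f i) \<in> X}"
    have "inj_on (v \<circ> f) I"
      by (intro comp_inj_on inj_on_subset[OF f(1)] inj_on_subset[OF berge_pathD(1)[OF B]])
        (use f(2) in \<open>auto simp: I_def\<close>)
    then have "card I \<le> card X"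
      by (rule card_inj_on_le) (auto simp: I_def X)
    moreover have "I = {..<k - 1} \<inter> {i. v (f i) \<in> X}" by (auto simp: I_def)
    ultimately show ?thesis by (simp add: sum.If_cases of_bool_def)
  qed
  have bound: "card (e i \<inter> X) - 1 \<le> of_bool (v i \<in> X) + of_bool (v (Suc i) \<in> X)"
    if i: "i < k - 1" for i
  proof -
    have "v i \<noteq> v (Suc i)" using inj_onD[OF berge_pathD(1)[OF B], of i "Suc i"] i by fastforce
    then have "card (e i - {v i, v (Suc i)}) = 1"
      using berge_pathD[OF B] i by (subst card_Diff_subset) auto
    then obtain w where "e i - {v i, v (Suc i)} = {w}" by (rule card_1_singletonE)
    then have "e i \<inter> X \<subseteq>
        (if v i \<in> X then {v i} else {}) \<union> (if v (Suc i) \<in> X then {v (Suc i)} else {}) \<union> {w}"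
      by auto
    then have "card (e i \<inter> X) \<le> card ((if v i \<in> X then {v i} else {}) \<union>
        (if v (Suc i) \<in> X then {v (Suc i)} else {}) \<union> {w})"
      by (intro card_mono) auto
    also have "\<dots> \<le> of_bool (v i \<in> X) + of_bool (v (Suc i) \<in> X) + 1"
      by (auto simp: card_insert_if)
    finally show ?thesis by simp
  qed
  have "excess k e X Y \<le> (\<Sum>i<k - 1. card (e i \<inter> X) - 1)"
    unfolding excess_def by (intro sum_mono2) auto
  also have "\<dots> \<le> (\<Sum>i<k - 1. of_bool (v i \<in> X) + of_bool (v (Suc i) \<in> X))"
    by (intro sum_mono bound) auto
  also have "\<dots> \<le> 2 * card X"
    using hit[of "\<lambda>i. i"] hit[of Suc] unfolding sum.distrib by fastforce
  finally show ?thesis .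
qed

text \<open>An edge with three vertices has multiplicity \<open>2\<close> only if it lies inside \<open>X\<close>.\<close>

lemma excess_le_card_within:
  assumes B: "berge_path k v e" and XY: "X \<subseteq> Y"
  shows "excess k e X Y \<le> card {i. i < k - 1 \<and> e i \<subseteq> X} + card {i. i < k - 1 \<and> e i \<subseteq> Y}"
proof -
  define I where "I = {i. i < k - 1 \<and> e i \<subseteq> Y}"
  have fin: "finite I" by (simp add: I_def)
  have "card (e i \<inter> X) - 1 \<le> of_bool (e i \<subseteq> X) + 1" if "i \<in> I" for i
  proof (cases "e i \<subseteq> X")
    case True
    then show ?thesis using that berge_pathD(3)[OF B, of i] by (simp add: I_def Int_absorb2)
  next
    case False
    then have "e i \<inter> X \<subset> e i" by blast
    then have "card (e i \<inter> X) < 3"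
      using that berge_pathD(3,4)[OF B, of i] psubset_card_mono[of "e i" "e i \<inter> X"] by (simp add: I_def)
    then show ?thesis by simp
  qed
  then have "excess k e X Y \<le> (\<Sum>i\<in>I. of_bool (e i \<subseteq> X) + 1)"
    unfolding excess_def I_def[symmetric] by (intro sum_mono)
  also have "\<dots> = card (I \<inter> {i. e i \<subseteq> X}) + card I"
    using fin by (simp only: sum.distrib of_bool_def sum.If_cases) simp
  also have "I \<inter> {i. e i \<subseteq> X} = {i. i < k - 1 \<and> e i \<subseteq> X}"
    using XY by (auto simp: I_def)
  finally show ?thesis by (simp add: I_def)
qed

text \<open>The edges counted here contain \<open>X\<close>, so they differ in their third vertex, which lies in \<open>Y - X\<close>.\<close>

lemma excess_doubleton_le:
  assumes B: "berge_path k v e" and X: "card X = 2" and XY: "X \<subseteq> Y" "finite Y"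
  shows "excess k e X Y \<le> card Y - 2"
proof -
  have finX: "finite X" using X by (intro card_ge_0_finite) simp
  define I where "I = {i. i < k - 1 \<and> e i \<subseteq> Y \<and> X \<subseteq> e i}"
  have bound: "card (e i \<inter> X) - 1 \<le> of_bool (X \<subseteq> e i)" for i
  proof (cases "X \<subseteq> e i")
    case True then show ?thesis using X by (simp add: Int_absorb1)
  next
    case False
    then have "e i \<inter> X \<subset> X" by blast
    then have "card (e i \<inter> X) < 2" using psubset_card_mono[OF finX] X by metis
    then show ?thesis by simp
  qed
  have "excess k e X Y \<le> (\<Sum>i | i < k - 1 \<and> e i \<subseteq> Y. of_bool (X \<subseteq> e i))"
    unfolding excess_def by (intro sum_mono bound)
  also have "\<dots> = card ({i. i < k - 1 \<and> e i \<subseteq> Y} \<inter> {i. X \<subseteq> e i})"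
    by (simp add: of_bool_def sum.If_cases)
  also have "\<dots> = card I"
    by (intro arg_cong[of _ _ card]) (auto simp: I_def)
  also have "\<dots> \<le> card ((\<lambda>y. {y}) ` (Y - X))"
  proof (rule card_inj_on_le[of "\<lambda>i. e i - X"])
    show "inj_on (\<lambda>i. e i - X) I"
    proof (rule inj_onI)
      fix i j assume "i \<in> I" "j \<in> I" "e i - X = e j - X"
      then have "e i = e j" "i < k - 1" "j < k - 1" by (auto simp: I_def)
      then show "i = j" using inj_onD[OF berge_pathD(2)[OF B], of i j] by simp
    qed
    show "(\<lambda>i. e i - X) ` I \<subseteq> (\<lambda>y. {y}) ` (Y - X)"
    proof clarify
      fix i assume i: "i \<in> I"
      then have "card (e i - X) = 1"
        using card_Diff_subset[OF finX, of "e i"] X berge_pathD(3)[OF B, of i] by (simp add: I_def)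
      then obtain y where y: "e i - X = {y}" by (rule card_1_singletonE)
      then have "y \<in> Y - X" using i by (auto simp: I_def)
      then show "e i - X \<in> (\<lambda>y. {y}) ` (Y - X)" using y by simp
    qed
  qed (use XY in auto)
  also have "\<dots> = card Y - 2"
    using card_Diff_subset[OF finX XY(1)] X by (simp add: card_image)
  finally show ?thesis .
qed

section \<open>The extremal hypergraph on ranks\<close>

text \<open>Rank \<open>0\<close> is the apex of the suspension and rank \<open>1\<close> the vertex where triangle and arms meet. Ranks \<open>2\<close>
  and \<open>3\<close> complete the triangle; the even ranks from \<open>4\<close> on form one arm and the odd ranks from \<open>5\<close> on the other, so
  the even arm is longer by one if the lengths differ. Thus \<open>parent m\<close> is the only smaller positive
  rank joined to \<open>m \<ge> 2\<close>, except that \<open>3\<close> is also joined to \<open>2\<close>.\<close>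

definition parent :: "nat \<Rightarrow> nat" where
  "parent m = (if m \<le> 5 then 1 else m - 2)"

definition ranked_Delta :: "nat \<Rightarrow> nat hypergraph" where
  "ranked_Delta k =
     Hypergraph {..<k} (insert {0, 2, 3} ((\<lambda>m. {0, parent m, m}) ` {2..<k}))"

text \<open>The edges of \<open>ranked_Delta k\<close> are indexed by \<open>{0<..<k}\<close>: the index \<open>1\<close>, which is no rank with a parent,
  stands for the triangle edge between \<open>2\<close> and \<open>3\<close>.\<close>

definition pair_lo :: "nat \<Rightarrow> nat" where "pair_lo m = (if m = 1 then 2 else parent m)"
definition pair_hi :: "nat \<Rightarrow> nat" where "pair_hi m = (if m = 1 then 3 else m)"

lemma parent_less: "2 \<le> m \<Longrightarrow> parent m < m"
  and parent_pos: "0 < parent m"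
  by (auto simp: parent_def)

lemma ranked_Delta_uniform:
  assumes "k \<ge> 6"
  shows "uniform_hypergraph 3 (ranked_Delta k)"
proof -
  have "{0, parent m, m} \<subseteq> {..<k} \<and> card {0, parent m, m} = 3" if "m \<in> {2..<k}" for m
    using that parent_less[of m] parent_pos[of m] by (auto simp: card_insert_if)
  then show ?thesis using assms by (auto simp: uniform_hypergraph_def ranked_Delta_def)
qed

lemma edge_form_ranked_Delta:
  assumes k: "k \<ge> 6"
  shows "edge_form 3 (ranked_Delta k) z =
    3 * (z 0 * (\<Sum>m\<in>{0<..<k}. z (pair_lo m) * z (pair_hi m)))"
proof -
  have Max: "Max {0, parent m, m} = m" if "m \<ge> 2" for m
    using that parent_less[of m] by (intro Max_eqI) auto
  have inj: "inj_on (\<lambda>m. {0, parent m, m}) {2..<k}"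
    by (rule inj_on_inverseI[of _ Max]) (simp add: Max del: Max_insert)
  have new: "{0, 2, 3} \<notin> (\<lambda>m. {0, parent m, m}) ` {2..<k}"
  proof
    assume "{0, 2, 3} \<in> (\<lambda>m. {0, parent m, m}) ` {2..<k}"
    then obtain m where m: "m \<ge> 2" "{0, 2, 3} = {0, parent m, m}" by auto
    have "m \<in> {0, 2, 3}" unfolding m(2) by simp
    then have "m = 2 \<or> m = 3" using m(1) by auto
    then have "parent m = 1" by (auto simp: parent_def)
    then have "1 \<in> {0, 2, 3::nat}" unfolding m(2) by simp
    then show False by simp
  qed
  have prod: "(\<Prod>v\<in>{0, parent m, m}. z v) = z 0 * (z (parent m) * z m)" if "m \<in> {2..<k}" for m
    using that parent_less[of m] parent_pos[of m] by simp
  have "(\<Sum>e\<in>edges (ranked_Delta k). \<Prod>v\<in>e. z v) =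
      z 0 * (z 2 * z 3) + (\<Sum>m\<in>{2..<k}. z 0 * (z (parent m) * z m))"
    using new prod by (simp add: ranked_Delta_def sum.reindex[OF inj])
  also have "\<dots> = z 0 * (\<Sum>m\<in>insert 1 {2..<k}. z (pair_lo m) * z (pair_hi m))"
    by (simp add: pair_lo_def pair_hi_def sum_distrib_left distrib_left)
  also have "insert 1 {2..<k} = {0<..<k}" using k by auto
  finally show ?thesis by (simp add: edge_form_def)
qed

lemma walk_edges_Cons_upt:
  assumes "x < c"
  shows "walk_edges (x # [c..<c + n]) =
    (\<lambda>i. {if i = 0 then x else c + i - 1, c + i}) ` {..<n}"
proof -
  have "walk_edges (x # [c..<c + n]) =
      (\<lambda>i. {(x # [c..<c + n]) ! i, (x # [c..<c + n]) ! Suc i}) ` {..<n}"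
    by (auto simp: walk_edges_def)
  also have "\<dots> = (\<lambda>i. {if i = 0 then x else c + i - 1, c + i}) ` {..<n}"
    by (intro image_cong refl) (auto simp: nth_Cons')
  finally show ?thesis .
qed

text \<open>The arm of length \<open>a = (k - 4) div 2\<close> starts with vertex \<open>3\<close> and is sent to the odd ranks \<open>5, 7, \<dots>\<close>; the
  arm of length \<open>b\<close>, which is \<open>a\<close> or \<open>a + 1\<close>, is sent to the even ranks \<open>4, 6, \<dots>\<close>.\<close>

lemma suspension_Delta1_iso_ranked_Delta:
  assumes k: "k \<ge> 6"
  shows "hypergraph_iso (suspension (Delta1 k)) (ranked_Delta k)"
proof -
  define a b where "a = (k - 4) div 2" and "b = (k - 3) div 2"
  have ab: "a + b + 4 = k" "a \<le> b" "b \<le> Suc a" using k unfolding a_def b_def by linarith+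
  have D: "Delta1 k = triangle_two_paths a b" using Delta1_div k by (simp add: a_def b_def)
  define g where "g v = (if v < 3 then v + 1 else if v < a + 3 then 5 + 2 * (v - 3)
    else 4 + 2 * (v - (a + 3)))" for v :: nat
  define f where "f u = (case u of None \<Rightarrow> 0 | Some v \<Rightarrow> g v)" for u
  have inj_g: "inj_on g {..<a + b + 3}"
  proof (rule inj_on_inverseI)
    fix v
    consider "v < 3" | i where "v = 3 + i" "i < a" | i where "v = a + 3 + i"
      by (metis add.commute le_Suc_ex linorder_not_less nat_add_left_cancel_less)
    then show "(if g v < 4 then g v - 1 else if odd (g v) then 3 + (g v - 5) div 2
        else a + 3 + (g v - 4) div 2) = v"
      by cases (simp_all add: g_def)
  qed
  have g_range: "0 < g v \<and> g v < k" if "v < a + b + 3" for v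
    using that ab by (auto simp: g_def)
  have V: "verts (suspension (Delta1 k)) = insert None (Some ` {..<a + b + 3})"
    by (simp add: suspension_def D triangle_two_paths_def)
  have "inj_on f (verts (suspension (Delta1 k)))"
    unfolding V using inj_g g_range by (fastforce simp: f_def inj_on_def)
  moreover have "f ` verts (suspension (Delta1 k)) \<subseteq> {..<k}"
    unfolding V using g_range k by (auto simp: f_def)
  moreover have "card (verts (suspension (Delta1 k))) = k"
    unfolding V using ab by (simp add: card_image)
  ultimately have bij: "bij_betw f (verts (suspension (Delta1 k))) {..<k}"
    by (simp add: bij_betw_def card_image card_subset_eq)
  have f_edge: "f ` insert None (Some ` e) = insert 0 (g ` e)" for e
    by (simp add: f_def image_image)
  have E: "edges (Delta1 k) = {{0, 1}, {1, 2}, {0, 2}}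
      \<union> (\<lambda>i. {if i = 0 then 0 else 3 + i - 1, 3 + i}) ` {..<a}
      \<union> (\<lambda>i. {if i = 0 then 0 else a + 3 + i - 1, a + 3 + i}) ` {..<b}"
    using walk_edges_Cons_upt[of 0 3 a] walk_edges_Cons_upt[of 0 "a + 3" b]
    by (simp add: D triangle_two_paths_def add_ac)
  define F where "F m = {0, parent m, m}" for m
  have A: "insert 0 (g ` {if i = 0 then 0 else 3 + i - 1, 3 + i}) = F (5 + 2 * i)" if "i < a" for i
    using that by (auto simp: g_def F_def parent_def)
  have B: "insert 0 (g ` {if i = 0 then 0 else a + 3 + i - 1, a + 3 + i}) = F (4 + 2 * i)" for i
    by (auto simp: g_def F_def parent_def)
  have T: "insert 0 (g ` {0, 1}) = F 2" "insert 0 (g ` {1, 2}) = {0, 2, 3}"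
    "insert 0 (g ` {0, 2}) = F 3"
    by (auto simp: g_def F_def parent_def)
  have range: "{2..<k} = {2, 3} \<union> (\<lambda>i. 5 + 2 * i) ` {..<a} \<union> (\<lambda>i. 4 + 2 * i) ` {..<b}"
  proof (intro equalityI subsetI)
    fix m assume m: "m \<in> {2..<k}"
    consider "m < 4" | "m \<ge> 4" "even m" | "m \<ge> 4" "odd m" by fastforce
    then show "m \<in> {2, 3} \<union> (\<lambda>i. 5 + 2 * i) ` {..<a} \<union> (\<lambda>i. 4 + 2 * i) ` {..<b}"
    proof cases
      case 1 then show ?thesis using m by auto
    next
      case 2
      then obtain q where "m = 2 * q" by (elim evenE)
      then have "m = 4 + 2 * (q - 2)" "q - 2 < b" using 2 m ab by auto
      then show ?thesis by blast
    next
      case 3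
      then obtain q where "m = 2 * q + 1" by (elim oddE)
      then have "m = 5 + 2 * (q - 2)" "q - 2 < a" using 3 m ab by auto
      then show ?thesis by blast
    qed
  next
    fix m assume "m \<in> {2, 3} \<union> (\<lambda>i. 5 + 2 * i) ` {..<a} \<union> (\<lambda>i. 4 + 2 * i) ` {..<b}"
    then show "m \<in> {2..<k}" using ab k by auto
  qed
  have "(\<lambda>e. f ` e) ` edges (suspension (Delta1 k)) = (\<lambda>e. insert 0 (g ` e)) ` edges (Delta1 k)"
    unfolding suspension_def hypergraph.sel image_image[of "\<lambda>e. f ` e"] f_edge ..
  also have "\<dots> = {F 2, {0, 2, 3}, F 3} \<union> (\<lambda>i. F (5 + 2 * i)) ` {..<a} \<union> (\<lambda>i. F (4 + 2 * i)) ` {..<b}"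
    unfolding E image_Un image_image image_insert image_empty T 
    using A B by (intro arg_cong2[where f = "(\<union>)"] image_cong refl) (auto simp: T[simplified])
  also have "\<dots> = insert {0, 2, 3} (F ` {2..<k})"
    unfolding range by (auto simp: image_image)
  also have "\<dots> = edges (ranked_Delta k)" by (simp add: ranked_Delta_def F_def)
  finally show ?thesis using bij by (auto simp: hypergraph_iso_def ranked_Delta_def)
qed

section \<open>The extremal hypergraph maximizes all counts\<close>

text \<open>The number of ordered pairs in \<open>{..<s} \<times> {..<t}\<close> that are joined, each pair \<open>{a i, b i}\<close> being counted
  once for every orientation that fits.\<close>

definition pair_count :: "'i set \<Rightarrow> ('i \<Rightarrow> nat) \<Rightarrow> ('i \<Rightarrow> nat) \<Rightarrow> nat \<Rightarrow> nat \<Rightarrow> nat" where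
  "pair_count I a b s t = (\<Sum>i\<in>I. of_bool (a i < s \<and> b i < t) + of_bool (b i < s \<and> a i < t))"

lemma pair_count_commute: "pair_count I a b s t = pair_count I a b t s"
  unfolding pair_count_def by (intro sum.cong) auto

abbreviation "Delta_count k \<equiv> pair_count {0<..<k} pair_lo pair_hi"

text \<open>Every rank \<open>m \<ge> 2\<close> is the larger end of the pair with its parent. Such a pair is counted in one
  orientation if \<open>m < s\<close>, and in the other if \<open>m < t\<close> and \<open>parent m < s\<close>, where the last condition
  amounts to \<open>m < max 6 (s + 2)\<close>. The remaining summands count the pair of \<open>2\<close> and \<open>3\<close>.\<close>

lemma Delta_count_eq:
  assumes k: "k \<ge> 6" and s: "2 \<le> s" "s \<le> t"
  shows "Delta_count k s t = of_bool (2 < s \<and> 3 < t) + of_bool (3 < s)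
    + (min s k - 2) + (min (min t k) (max 6 (s + 2)) - 2)"
proof -
  have "{0<..<k} = insert 1 {2..<k}" using k by auto
  then have "Delta_count k s t = of_bool (2 < s \<and> 3 < t) + of_bool (3 < s \<and> 2 < t)
      + (\<Sum>m\<in>{2..<k}. of_bool (parent m < s \<and> m < t) + of_bool (m < s \<and> parent m < t))"
    by (simp add: pair_count_def pair_lo_def pair_hi_def)
  also have "(\<Sum>m\<in>{2..<k}. of_bool (parent m < s \<and> m < t) + of_bool (m < s \<and> parent m < t)) =
      (\<Sum>m\<in>{2..<k}. of_bool (m < min t (max 6 (s + 2))) + of_bool (m < s) :: nat)"
  proof (intro sum.cong refl)
    fix m assume "m \<in> {2..<k}"
    then have "parent m < s \<longleftrightarrow> m < max 6 (s + 2)" "m < s \<Longrightarrow> parent m < t"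
      using s by (auto simp: parent_def)
    then show "of_bool (parent m < s \<and> m < t) + of_bool (m < s \<and> parent m < t) =
        (of_bool (m < min t (max 6 (s + 2))) + of_bool (m < s) :: nat)"
      using s by auto
  qed
  also have "\<dots> = card ({2..<k} \<inter> {m. m < min t (max 6 (s + 2))}) + card ({2..<k} \<inter> {m. m < s})"
    by (simp add: sum.distrib of_bool_def sum.If_cases)
  also have "{2..<k} \<inter> {m. m < min t (max 6 (s + 2))} = {2..<min (min t k) (max 6 (s + 2))}" by auto
  also have "{2..<k} \<inter> {m. m < s} = {2..<min s k}" by auto
  also have "(3 < s \<and> 2 < t) = (3 < s)" using s by auto
  finally show ?thesis by (simp only: card_atLeastLessThan ac_simps)
qed

text \<open>This is where the shape of \<open>Delta1 k\<close> comes from: for \<open>card X = 2\<close> the bounds are \<open>card Y - 2\<close> and \<open>4\<close>; for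
  \<open>card X = 3\<close> there is at most one edge inside \<open>X\<close>; and for larger \<open>X\<close> the bounds are \<open>2 * card X\<close> and
  the number of edges inside \<open>X\<close> plus the number of those inside \<open>Y\<close>. Their minimum is what
  \<open>ranked_Delta k\<close> attains. The hypothesis \<open>k \<ge> 6\<close> gives the centre its degree \<open>4\<close>.\<close>

lemma excess_le_Delta_count:
  assumes B: "berge_path k v e" and k: "k \<ge> 6" and XY: "X \<subseteq> Y" "finite Y"
  shows "excess k e X Y \<le> Delta_count k (card X) (card Y)"
proof -
  have finX: "finite X" using XY finite_subset by blast
  have le: "card X \<le> card Y" using XY card_mono by blast
  have edges_le: "card {i. i < k - 1 \<and> e i \<subseteq> Z} \<le> min (card Z) k - 1" if "finite Z" "Z \<noteq> {}" for Z
  proof -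
    have "card {i. i < k - 1 \<and> e i \<subseteq> Z} \<le> card {..<k - 1}" by (intro card_mono) auto
    then show ?thesis using card_edges_within_less[OF B that] by simp
  qed
  consider "card X \<le> 1" | "card X = 2" | "card X = 3" | "card X \<ge> 4" by linarith
  then show ?thesis
  proof cases
    case 1
    have "card (e i \<inter> X) \<le> 1" for i
      using card_mono[OF finX, of "e i \<inter> X"] 1 by simp
    then have "excess k e X Y = 0" by (simp add: excess_def)
    then show ?thesis by simp
  next
    case 2
    show ?thesis
      using excess_doubleton_le[OF B 2 XY] excess_le_double[OF B finX, of Y] le k 2
      by (simp add: Delta_count_eq)
  next
    case 3
    then have ne: "Y \<noteq> {}" using le by auto
    show ?thesis
      using excess_le_card_within[OF B XY(1)] card_edges_within_3[OF B 3] edges_le[OF XY(2) ne]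
        excess_le_double[OF B finX, of Y] card_edges_within_3[OF B, of Y] le k 3
      by (cases "card Y = 3") (auto simp: Delta_count_eq)
  next
    case 4
    then have ne: "Y \<noteq> {}" "X \<noteq> {}" using le by auto
    show ?thesis
      using excess_le_card_within[OF B XY(1)] edges_le[OF XY(2) ne(1)] edges_le[OF finX ne(2)]
        excess_le_double[OF B finX, of Y] le k 4 Delta_count_eq[OF k _ le]
      by (simp add: max_def) arith
  qed
qed

section \<open>From counts to sums of products\<close>

text \<open>The function \<open>z\<close> is a combination of the indicators of the segments \<open>{..<t}\<close>, whose coefficients are
  the drops of \<open>z\<close>.\<close>

lemma layer_cake:
  fixes z :: "nat \<Rightarrow> real"
  assumes "\<And>m. m \<ge> n \<Longrightarrow> z m = 0"
  shows "z m = (\<Sum>t\<in>{1..n}. (z (t - 1) - z t) * of_bool (m < t))"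
proof (cases "m < n")
  case True
  have "(\<Sum>t\<in>{1..n}. (z (t - 1) - z t) * of_bool (m < t)) = (\<Sum>t\<in>{Suc m..n}. z (t - 1) - z t)"
    by (intro sum.mono_neutral_cong_right) auto
  also have "\<dots> = (\<Sum>t\<in>{m..<n}. z t - z (Suc t))"
    by (intro sum.reindex_bij_witness[of _ Suc "\<lambda>t. t - 1"]) auto
  also have "\<dots> = - (\<Sum>t\<in>{m..<n}. z (Suc t) - z t)"
    by (simp add: sum_negf[symmetric])
  also have "\<dots> = z m" using True assms[of n] by (simp add: sum_Suc_diff')
  finally show ?thesis by simp
next
  case False
  then show ?thesis using assms[of m] by (auto intro!: sum.neutral)
qed

lemma layer_cake_pairs:
  fixes z :: "nat \<Rightarrow> real"
  assumes z: "\<And>m. m \<ge> n \<Longrightarrow> z m = 0"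
  shows "2 * (\<Sum>i\<in>I. z (a i) * z (b i)) =
    (\<Sum>s\<in>{1..n}. \<Sum>t\<in>{1..n}. (z (s - 1) - z s) * (z (t - 1) - z t) * real (pair_count I a b s t))"
    (is "_ = ?R")
proof -
  define c where "c t = z (t - 1) - z t" for t
  have zz: "z p * z q = (\<Sum>s\<in>{1..n}. \<Sum>t\<in>{1..n}. c s * c t * of_bool (p < s \<and> q < t))" for p q
  proof -
    have "z p * z q = (\<Sum>s\<in>{1..n}. c s * of_bool (p < s)) * (\<Sum>t\<in>{1..n}. c t * of_bool (q < t))"
      unfolding c_def by (intro arg_cong2[where f = "(*)"] layer_cake z)
    then show ?thesis by (simp only: sum_product of_bool_conj mult_ac)
  qed
  have "2 * (\<Sum>i\<in>I. z (a i) * z (b i)) = (\<Sum>i\<in>I. z (a i) * z (b i) + z (b i) * z (a i))"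
    by (simp add: sum_distrib_left mult.commute)
  also have "\<dots> = (\<Sum>i\<in>I. \<Sum>s\<in>{1..n}. \<Sum>t\<in>{1..n}. c s * c t *
      (of_bool (a i < s \<and> b i < t) + of_bool (b i < s \<and> a i < t)))"
    unfolding zz by (simp add: sum.distrib distrib_left)
  also have "\<dots> = (\<Sum>s\<in>{1..n}. \<Sum>i\<in>I. \<Sum>t\<in>{1..n}. c s * c t *
      (of_bool (a i < s \<and> b i < t) + of_bool (b i < s \<and> a i < t)))"
    by (rule sum.swap)
  also have "\<dots> = (\<Sum>s\<in>{1..n}. \<Sum>t\<in>{1..n}. \<Sum>i\<in>I. c s * c t *
      (of_bool (a i < s \<and> b i < t) + of_bool (b i < s \<and> a i < t)))"
    by (intro sum.cong refl, rule sum.swap)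
  also have "\<dots> = ?R"
    by (simp add: c_def pair_count_def sum_distrib_left)
  finally show ?thesis .
qed

text \<open>For decreasing \<open>z\<close> the coefficients in \<open>layer_cake_pairs\<close> are nonnegative, so it suffices to compare
  counts. If the sums agree, then the counts agree wherever both coefficients are positive.\<close>

lemma pair_sum_mono:
  fixes z :: "nat \<Rightarrow> real"
  assumes dec: "decseq z" and z: "\<And>m. m \<ge> n \<Longrightarrow> z m = 0"
    and count: "\<And>s t. s \<le> t \<Longrightarrow> pair_count I a b s t \<le> pair_count J c d s t"
  shows "(\<Sum>i\<in>I. z (a i) * z (b i)) \<le> (\<Sum>j\<in>J. z (c j) * z (d j))"
    and "(\<Sum>i\<in>I. z (a i) * z (b i)) = (\<Sum>j\<in>J. z (c j) * z (d j)) \<Longrightarrow>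
      0 < s \<Longrightarrow> 0 < t \<Longrightarrow> z s < z (s - 1) \<Longrightarrow> z t < z (t - 1) \<Longrightarrow>
      pair_count I a b s t = pair_count J c d s t"
proof -
  have count': "pair_count I a b s t \<le> pair_count J c d s t" for s t
    using count[of s t] count[of t s] pair_count_commute[of I a b s t] pair_count_commute[of J c d s t]
    by (cases "s \<le> t") auto
  define g where "g t = z (t - 1) - z t" for t
  have g: "0 \<le> g t" for t using decseqD[OF dec, of "t - 1" t] by (simp add: g_def)
  define f where "f P = g (fst P) * g (snd P) *
      (real (pair_count J c d (fst P) (snd P)) - real (pair_count I a b (fst P) (snd P)))" for P
  have f: "0 \<le> f P" for P using g count' by (auto simp: f_def)
  have diff: "2 * (\<Sum>j\<in>J. z (c j) * z (d j)) - 2 * (\<Sum>i\<in>I. z (a i) * z (b i)) =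
      sum f ({1..n} \<times> {1..n})"
    unfolding sum.cartesian_product' f_def g_def
    by (simp only: layer_cake_pairs[of n z, OF z] right_diff_distrib sum_subtractf fst_conv snd_conv)
  then show "(\<Sum>i\<in>I. z (a i) * z (b i)) \<le> (\<Sum>j\<in>J. z (c j) * z (d j))"
    using sum_nonneg[of "{1..n} \<times> {1..n}" f] f by simp
  assume eq: "(\<Sum>i\<in>I. z (a i) * z (b i)) = (\<Sum>j\<in>J. z (c j) * z (d j))"
    and st: "0 < s" "0 < t" "z s < z (s - 1)" "z t < z (t - 1)"
  have range: "u \<le> n" if "0 < u" "z u < z (u - 1)" for u
    using that z[of u] z[of "u - 1"] by (cases "u \<le> n") force+
  have "sum f ({1..n} \<times> {1..n}) = 0" using diff eq by simp
  then have "f (s, t) = 0"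
    using f range st by (subst (asm) sum_nonneg_eq_0_iff) (auto simp: Suc_le_eq)
  then show "pair_count I a b s t = pair_count J c d s t"
    using st by (auto simp: f_def g_def)
qed

lemma card_3_ordered:
  fixes e :: "nat set"
  assumes "card e = 3"
  shows "\<exists>a b c. e = {a, b, c} \<and> a < b \<and> b < c"
proof -
  obtain a b c where e: "e = {a, b, c}" "a \<noteq> b" "b \<noteq> c" "a \<noteq> c"
    using assms by (auto simp: card_3_iff)
  define P where "P a b c \<longleftrightarrow> e = {a, b, c} \<and> a < b \<and> b < c" for a b c
  have "P a b c \<or> P a c b \<or> P b a c \<or> P b c a \<or> P c a b \<or> P c b a"
    using e unfolding P_def by auto
  then show ?thesis unfolding P_def by blast
qed

text \<open>The vertices are now ranks, and the vertices of each edge are listed in increasing order of rank,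
  that is, heaviest vertex first.\<close>

locale ranked_berge_path =
  fixes k :: nat and v :: "nat \<Rightarrow> nat" and e :: "nat \<Rightarrow> nat set" and lo mid hi :: "nat \<Rightarrow> nat"
  assumes k: "k \<ge> 6" and path: "berge_path k v e"
    and edge: "\<And>i. i < k - 1 \<Longrightarrow> e i = {lo i, mid i, hi i}"
    and order: "\<And>i. i < k - 1 \<Longrightarrow> lo i < mid i \<and> mid i < hi i"
begin

abbreviation "path_count \<equiv> pair_count {..<k - 1} mid hi"

text \<open>The pair \<open>(mid i, hi i)\<close> arises from \<open>e i\<close> by dropping the least rank. For initial segments the dropped
  rank is the vertex that \<open>excess\<close> discounts, so that \<open>path_count\<close> is an \<open>excess\<close>.\<close>

lemma path_count_le:
  assumes "s \<le> t"
  shows "path_count s t \<le> Delta_count k s t"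
proof -
  have "of_bool (mid i < s \<and> hi i < t) + of_bool (hi i < s \<and> mid i < t) =
      (if e i \<subseteq> {..<t} then card (e i \<inter> {..<s}) - 1 else 0)" if i: "i < k - 1" for i
    using order[OF i] assms by (auto simp: edge[OF i] Int_insert_left card_insert_if)
  then have "path_count s t = (\<Sum>i<k - 1. if e i \<subseteq> {..<t} then card (e i \<inter> {..<s}) - 1 else 0)"
    unfolding pair_count_def by (intro sum.cong) auto
  also have "\<dots> = excess k e {..<s} {..<t}"
    unfolding excess_def by (simp add: sum.inter_filter[symmetric])
  also have "\<dots> \<le> Delta_count k (card {..<s}) (card {..<t})"
    using assms by (intro excess_le_Delta_count[OF path k]) auto
  finally show ?thesis by simp
qed

context
  fixes z :: "nat \<Rightarrow> real" and n :: nat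
  assumes decreasing: "decseq z" and nonneg: "\<And>m. z m \<ge> 0" and support: "\<And>m. m \<ge> n \<Longrightarrow> z m = 0"
begin

abbreviation "path_sum \<equiv> \<Sum>i<k - 1. \<Prod>m\<in>e i. z m"
abbreviation "mid_hi_sum \<equiv> \<Sum>i<k - 1. z (mid i) * z (hi i)"
abbreviation "Delta_sum \<equiv> \<Sum>m\<in>{0<..<k}. z (pair_lo m) * z (pair_hi m)"

lemma path_sum_eq: "path_sum = (\<Sum>i<k - 1. z (lo i) * (z (mid i) * z (hi i)))"
proof (intro sum.cong refl)
  fix i assume "i \<in> {..<k - 1}"
  then show "(\<Prod>m\<in>e i. z m) = z (lo i) * (z (mid i) * z (hi i))"
    using edge[of i] order[of i] by simp
qed

lemma path_term_le: "z (lo i) * (z (mid i) * z (hi i)) \<le> z 0 * (z (mid i) * z (hi i))"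
  using decseqD[OF decreasing, of 0 "lo i"] nonneg by (intro mult_right_mono) auto

lemma path_sum_le: "path_sum \<le> z 0 * mid_hi_sum"
  unfolding path_sum_eq sum_distrib_left by (intro sum_mono path_term_le)

lemma mid_hi_sum_le: "mid_hi_sum \<le> Delta_sum"
  using decreasing support path_count_le by (rule pair_sum_mono(1))

lemma path_sum_le_Delta: "path_sum \<le> z 0 * Delta_sum"
  using path_sum_le mult_left_mono[OF mid_hi_sum_le nonneg[of 0]] by simp

text \<open>Equality forces equality in both steps, the comparison of counts and the replacement of the
  heaviest vertex of each edge by rank \<open>0\<close>.\<close>

lemma path_sum_eqD:
  assumes eq: "path_sum = z 0 * Delta_sum" and z0: "z 0 > 0"
  shows "\<And>s t. 0 < s \<Longrightarrow> 0 < t \<Longrightarrow> z s < z (s - 1) \<Longrightarrow> z t < z (t - 1) \<Longrightarrow>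
      path_count s t = Delta_count k s t"
    and "\<And>i. i < k - 1 \<Longrightarrow> z (mid i) > 0 \<Longrightarrow> z (hi i) > 0 \<Longrightarrow> z (lo i) = z 0"
proof -
  have "z 0 * Delta_sum \<le> z 0 * mid_hi_sum" using eq path_sum_le by simp
  then have eq2: "mid_hi_sum = Delta_sum" using mid_hi_sum_le z0 by simp
  show "path_count s t = Delta_count k s t"
    if "0 < s" "0 < t" "z s < z (s - 1)" "z t < z (t - 1)" for s t
    using pair_sum_mono(2)[OF decreasing support path_count_le eq2] that by blast
  fix i assume i: "i < k - 1" "z (mid i) > 0" "z (hi i) > 0"
  have "(\<Sum>i<k - 1. z 0 * (z (mid i) * z (hi i)) - z (lo i) * (z (mid i) * z (hi i))) = 0"
    using eq[unfolded path_sum_eq] eq2 by (simp add: sum_subtractf flip: sum_distrib_left)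
  then have "z 0 * (z (mid i) * z (hi i)) - z (lo i) * (z (mid i) * z (hi i)) = 0"
    using i(1) path_term_le by (subst (asm) sum_nonneg_eq_0_iff) auto
  then show "z (lo i) = z 0" using i by simp
qed

end

end

lemma exists_ranked_berge_path:
  fixes e :: "nat \<Rightarrow> nat set"
  assumes "k \<ge> 6" and path: "berge_path k v e"
  obtains lo mid hi where "ranked_berge_path k v e lo mid hi"
proof -
  have "\<forall>i. \<exists>a b c. i < k - 1 \<longrightarrow> e i = {a, b, c} \<and> a < b \<and> b < c"
    using card_3_ordered berge_pathD(3)[OF path] by metis
  then obtain lo mid hi where "\<forall>i. i < k - 1 \<longrightarrow> e i = {lo i, mid i, hi i} \<and> lo i < mid i \<and> mid i < hi i"
    by metis
  then show ?thesis using that[of lo mid hi] assms by (simp add: ranked_berge_path_def)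
qed

section \<open>Maximizers on the extremal hypergraph\<close>

lemma verts_ranked_Delta: "verts (ranked_Delta k) = {..<k}"
  by (simp add: ranked_Delta_def)

lemma p_spectral_radius_ranked_Delta_pos:
  assumes k: "k \<ge> 6" and p: "p \<ge> 1"
  shows "p_spectral_radius 3 p (ranked_Delta k) > 0"
proof -
  have "0 < edge_form 3 (ranked_Delta k) (\<lambda>_. 1)" using k by (simp add: edge_form_ranked_Delta)
  also have "\<dots> \<le> p_spectral_radius 3 p (ranked_Delta k) * (real k powr (1 / p)) ^ 3"
    using edge_form_le_scaled[OF ranked_Delta_uniform[OF k] _ p, of "\<lambda>_. 1"]
    by (simp add: verts_ranked_Delta)
  finally show ?thesis by (simp add: zero_less_mult_iff)
qed

text \<open>A maximizer on \<open>ranked_Delta k\<close> whose coordinates decrease with the rank. It is continued by \<open>0\<close> beyond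
  the vertex set, so that the ends of the arms need no separate treatment below.\<close>

locale Delta_maximizer =
  fixes k :: nat and p :: real and z :: "nat \<Rightarrow> real"
  assumes k: "k \<ge> 6" and p: "p > 1"
    and decreasing: "decseq z" and nonneg: "\<And>m. z m \<ge> 0" and support: "\<And>m. m \<ge> k \<Longrightarrow> z m = 0"
    and norm: "(\<Sum>m<k. z m powr p) = 1"
    and maximal: "edge_form 3 (ranked_Delta k) z = p_spectral_radius 3 p (ranked_Delta k)"
begin

abbreviation "pair_sum y \<equiv> \<Sum>m\<in>{0<..<k}. y (pair_lo m) * y (pair_hi m)"

abbreviation "radius \<equiv> p_spectral_radius 3 p (ranked_Delta k)"

lemma radius_pos: "radius > 0"
  using p_spectral_radius_ranked_Delta_pos[OF k] p by simp

lemma scaled_bound: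
  assumes "\<And>m. y m \<ge> 0"
  shows "3 * (y 0 * pair_sum y) \<le> radius * ((\<Sum>m<k. y m powr p) powr (1 / p)) ^ 3"
  using edge_form_le_scaled[OF ranked_Delta_uniform[OF k], of p y] p assms
  by (simp add: edge_form_ranked_Delta[OF k] verts_ranked_Delta)

lemma maximal': "radius = 3 * (z 0 * pair_sum z)"
  using maximal edge_form_ranked_Delta[OF k] by simp

lemma z2_pos: "z 2 > 0"
proof -
  have "pair_sum z > 0" using radius_pos nonneg[of 0] by (simp add: maximal' zero_less_mult_iff)
  then obtain m where m: "m \<in> {0<..<k}" "z (pair_lo m) * z (pair_hi m) > 0"
    by (meson sum_nonpos not_less)
  then have "z (pair_hi m) > 0" using nonneg by (simp add: zero_less_mult_iff) (metis less_le)
  moreover have "pair_hi m \<ge> 2" using m(1) by (auto simp: pair_hi_def)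
  ultimately show ?thesis using decseqD[OF decreasing, of 2 "pair_hi m"] by simp
qed

text \<open>Raising a zero coordinate \<open>m\<close> to \<open>\<epsilon>\<close> gains at least \<open>3 * z 0 * z (parent m) * \<epsilon>\<close> in the form, whereas
  the sum of the \<open>p\<close>-th powers grows only by \<open>\<epsilon> powr p\<close>. Rescaling to norm \<open>1\<close> turns this into an upper
  bound for the gain, with room to spare in the factor \<open>7\<close>.\<close>

lemma raise_zero_coordinate:
  assumes m: "2 \<le> m" "m < k" and zm: "z m = 0" and \<epsilon>: "0 < \<epsilon>" "\<epsilon> \<le> 1"
  shows "3 * (z 0 * z (parent m)) \<le> 7 * radius * \<epsilon> powr (p - 1)"
proof -
  define y where "y = z(m := \<epsilon>)"
  have y: "y i \<ge> z i" for i using zm \<epsilon> by (simp add: y_def)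
  have y0: "y i \<ge> 0" for i using y nonneg order_trans by blast
  have other: "y i = z i" if "i \<noteq> m" for i using that by (simp add: y_def)
  have lo_hi: "pair_lo m = parent m" "pair_hi m = m" "m \<in> {0<..<k}" "parent m \<noteq> m"
    using m parent_less[of m] by (auto simp: pair_lo_def pair_hi_def)
  have "pair_sum z + z (parent m) * \<epsilon> =
      (\<Sum>i\<in>{0<..<k} - {m}. z (pair_lo i) * z (pair_hi i)) + y (parent m) * y m"
    using lo_hi zm by (simp add: sum.remove[of _ m] other) (simp add: y_def)
  also have "\<dots> \<le> (\<Sum>i\<in>{0<..<k} - {m}. y (pair_lo i) * y (pair_hi i)) + y (parent m) * y m"
    by (intro add_mono sum_mono mult_mono y y0 nonneg order_refl)
  also have "\<dots> = pair_sum y" using lo_hi by (simp add: sum.remove[of _ m])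
  finally have "3 * (z 0 * (pair_sum z + z (parent m) * \<epsilon>)) \<le> 3 * (z 0 * pair_sum y)"
    by (intro mult_left_mono nonneg) simp_all
  also have "\<dots> = 3 * (y 0 * pair_sum y)" using m by (simp add: other)
  also have "\<dots> \<le> radius * ((\<Sum>m<k. y m powr p) powr (1 / p)) ^ 3" by (rule scaled_bound[OF y0])
  also have "(\<Sum>m<k. y m powr p) = 1 + \<epsilon> powr p"
  proof -
    have "(\<Sum>i<k. y i powr p) = \<epsilon> powr p + (\<Sum>i\<in>{..<k} - {m}. z i powr p)"
      using m by (simp add: sum.remove[of _ m] y_def)
    also have "(\<Sum>i\<in>{..<k} - {m}. z i powr p) = (\<Sum>i<k. z i powr p)"
      using m zm by (simp add: sum.remove[of "{..<k}" m])
    finally show ?thesis using norm by simp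
  qed
  also have "radius * ((1 + \<epsilon> powr p) powr (1 / p)) ^ 3 \<le> radius * (1 + 7 * \<epsilon> powr p)"
  proof (intro mult_left_mono)
    define t where "t = \<epsilon> powr p"
    have t: "0 \<le> t" "t \<le> 1" using \<epsilon> p by (auto simp: t_def powr_le1)
    have "(1 + t) powr (1 / p) \<le> (1 + t) powr 1" using t p by (intro powr_mono) auto
    then have "((1 + t) powr (1 / p)) ^ 3 \<le> (1 + t) ^ 3" using t by (intro power_mono) auto
    also have "\<dots> = 1 + 3 * t + 3 * (t * t) + t * t * t" by (simp add: power3_eq_cube algebra_simps)
    also have "\<dots> \<le> 1 + 7 * t"
    proof -
      have "t * t \<le> t" using t by (simp add: mult_left_le)
      moreover have "t * t * t \<le> t" using t by (simp add: mult_le_one mult_left_le mult.assoc)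
      ultimately show ?thesis by simp
    qed
    finally show "((1 + \<epsilon> powr p) powr (1 / p)) ^ 3 \<le> 1 + 7 * \<epsilon> powr p" by (simp add: t_def)
  qed (use radius_pos in simp)
  also have "radius * (1 + 7 * \<epsilon> powr p) = 3 * (z 0 * pair_sum z) + 7 * radius * \<epsilon> powr (p - 1) * \<epsilon>"
  proof -
    have "\<epsilon> powr p = \<epsilon> powr (p - 1) * \<epsilon>" using \<epsilon> powr_mult_base[of \<epsilon> "p - 1"] by (simp add: mult.commute)
    then show ?thesis unfolding distrib_left maximal'[symmetric] by simp
  qed
  finally have "3 * (z 0 * z (parent m)) * \<epsilon> \<le> 7 * radius * \<epsilon> powr (p - 1) * \<epsilon>"
    by (simp add: algebra_simps)
  then show ?thesis using \<epsilon> by (simp only: mult_le_cancel_right_pos)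
qed

text \<open>By induction both \<open>z 0\<close> and \<open>z (parent m)\<close> are positive. If \<open>z m\<close> were \<open>0\<close>, then a small \<open>\<epsilon>\<close> would violate
  \<open>raise_zero_coordinate\<close>, because \<open>p > 1\<close>.\<close>

lemma pos: "m < k \<Longrightarrow> z m > 0"
proof (induction m rule: less_induct)
  case (less m)
  show ?case
  proof (cases "m \<le> 2")
    case True
    then show ?thesis using z2_pos decseqD[OF decreasing True] by simp
  next
    case False
    show ?thesis
    proof (rule ccontr)
      assume "\<not> z m > 0"
      then have zm: "z m = 0" using nonneg[of m] by simp
      define c where "c = 3 * (z 0 * z (parent m))"
      have c: "c > 0" using less False parent_less[of m] by (simp add: c_def)
      \<comment> \<open>For this \<open>\<epsilon>\<close> the upper bound of \<open>raise_zero_coordinate\<close> is at most \<open>c / 2\<close>.\<close>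
      define \<eta> where "\<eta> = c / (14 * radius)"
      define \<epsilon> where "\<epsilon> = min 1 (\<eta> powr (1 / (p - 1)))"
      have \<eta>: "\<eta> > 0" using c radius_pos by (simp add: \<eta>_def)
      then have \<epsilon>: "0 < \<epsilon>" "\<epsilon> \<le> 1" by (auto simp: \<epsilon>_def)
      have "\<epsilon> powr (p - 1) \<le> (\<eta> powr (1 / (p - 1))) powr (p - 1)"
        using \<epsilon> p by (intro powr_mono2) (auto simp: \<epsilon>_def)
      also have "\<dots> = \<eta>" using \<eta> p by (simp add: powr_powr)
      finally have "7 * radius * \<epsilon> powr (p - 1) \<le> 7 * radius * \<eta>"
        using radius_pos by (intro mult_left_mono) auto
      also have "\<dots> = c / 2" using radius_pos by (simp add: \<eta>_def)
      finally show False
        using raise_zero_coordinate[OF _ less.prems zm \<epsilon>] False c by (simp add: c_def)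
    qed
  qed
qed

text \<open>The sum of \<open>z\<close> over the ranks joined to \<open>w\<close> in the graph under the suspension.\<close>

definition nbr :: "nat \<Rightarrow> real" where
  "nbr w = (\<Sum>m\<in>{0<..<k}.
     of_bool (pair_lo m = w) * z (pair_hi m) + of_bool (pair_hi m = w) * z (pair_lo m))"

text \<open>A third of the partial derivative of the form at \<open>z\<close> in direction \<open>w\<close>.\<close>

definition partial :: "nat \<Rightarrow> real" where
  "partial w = of_bool (w = 0) * pair_sum z + z 0 * nbr w"

text \<open>Shift \<open>p\<close>-th powers from coordinate \<open>v\<close> to coordinate \<open>u\<close>: \<open>z u powr p\<close> becomes \<open>t + \<delta>\<close> and
  \<open>z v powr p\<close> becomes \<open>t - \<delta>\<close>. The norm stays \<open>1\<close>, so the form has a local maximum at \<open>\<delta> = 0\<close>. Its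
  derivative there is a positive multiple of the difference of the partial derivatives: since the
  two coordinates are equal, they move with opposite speeds.\<close>

lemma tie_partial_eq:
  assumes uv: "u < k" "v < k" "u \<noteq> v" and tie: "z u = z v"
  shows "partial u = partial v"
proof -
  define t where "t = z u powr p"
  have t: "t > 0" "t powr (1 / p) = z u" "t = z v powr p"
    using pos[OF uv(1)] p tie by (auto simp: t_def powr_powr)
  define q where "q = 1 / p * t powr (1 / p - 1)"
  have q: "q > 0" using t p by (simp add: q_def)
  define y where "y \<delta> i = (if i = u then (t + \<delta>) powr (1 / p)
    else if i = v then (t - \<delta>) powr (1 / p) else z i)" for \<delta> i
  define d where "d i = q * (of_bool (i = u) - of_bool (i = v))" for i
  have y0: "y 0 = z" using t tie by (auto simp: y_def fun_eq_iff)
  have y_deriv: "((\<lambda>\<delta>. y \<delta> i) has_real_derivative d i) (at 0)" for i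
    unfolding y_def d_def q_def using t uv(3)
    by (cases "i = u"; cases "i = v") (auto intro!: derivative_eq_intros)
  define F where "F \<delta> = y \<delta> 0 * pair_sum (y \<delta>)" for \<delta>
  define L where "L = d 0 * pair_sum z + z 0 * (\<Sum>m\<in>{0<..<k}.
      d (pair_lo m) * z (pair_hi m) + d (pair_hi m) * z (pair_lo m))"
  have "(F has_real_derivative L) (at 0)"
    unfolding F_def L_def
    by (rule derivative_eq_intros y_deriv refl)+ (simp add: y0 algebra_simps)
  moreover have "F \<delta> \<le> F 0" if \<delta>: "\<bar>0 - \<delta>\<bar> < t" for \<delta>
  proof -
    have split: "(\<Sum>i<k. f i) = f u + f v + (\<Sum>i\<in>{..<k} - {u} - {v}. f i)" for f :: "nat \<Rightarrow> real"
      using uv by (simp add: sum.remove[of "{..<k}" u] sum.remove[of "{..<k} - {u}" v])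
    have "(\<Sum>i<k. y \<delta> i powr p) = (t + \<delta>) + (t - \<delta>) + (\<Sum>i\<in>{..<k} - {u} - {v}. z i powr p)"
      using \<delta> p uv by (subst split) (auto simp: y_def powr_powr intro!: sum.cong)
    also have "\<dots> = (\<Sum>i<k. z i powr p)" using t by (subst split) (simp add: t_def)
    finally have "(\<Sum>i<k. y \<delta> i powr p) = 1" using norm by simp
    moreover have "y \<delta> i \<ge> 0" for i using nonneg by (simp add: y_def)
    ultimately have "3 * (y \<delta> 0 * pair_sum (y \<delta>)) \<le> radius" using scaled_bound[of "y \<delta>"] by simp
    then show ?thesis using maximal' by (simp add: F_def y0)
  qed
  ultimately have "L = 0" using DERIV_local_max t(1) by blast
  moreover have "L = q * (partial u - partial v)"
  proof -
    have nbrs: "(\<Sum>m\<in>{0<..<k}. d (pair_lo m) * z (pair_hi m) + d (pair_hi m) * z (pair_lo m)) =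
        q * (nbr u - nbr v)"
      unfolding nbr_def sum_subtractf[symmetric] sum_distrib_left
      by (intro sum.cong refl) (simp only: d_def ring_distribs mult_ac)
    show ?thesis unfolding L_def nbrs partial_def by (simp add: d_def algebra_simps)
  qed
  ultimately show ?thesis using q by simp
qed

lemma nbr_eq:
  "nbr 1 = z 2 + z 3 + z 4 + z 5" "nbr 2 = z 1 + z 3" "nbr 3 = z 1 + z 2"
  "\<And>w. 4 \<le> w \<Longrightarrow> w < k \<Longrightarrow> nbr w = z (parent w) + z (w + 2)"
proof -
  have set: "{0<..<k} = insert 1 {2..<k}" using k by auto
  have gen: "nbr w = of_bool (w = 2) * z 3 + of_bool (w = 3) * z 2
      + (\<Sum>m\<in>{2..<k}. of_bool (parent m = w) * z m)
      + (\<Sum>m\<in>{2..<k}. of_bool (m = w) * z (parent m))" for w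
  proof -
    define T where "T m = of_bool (pair_lo m = w) * z (pair_hi m)
      + of_bool (pair_hi m = w) * z (pair_lo m)" for m
    have "nbr w = T 1 + (\<Sum>m\<in>{2..<k}. T m)"
      unfolding nbr_def T_def[symmetric] set by simp
    also have "(\<Sum>m\<in>{2..<k}. T m) =
        (\<Sum>m\<in>{2..<k}. of_bool (parent m = w) * z m + of_bool (m = w) * z (parent m))"
      by (intro sum.cong refl) (simp add: T_def pair_lo_def pair_hi_def)
    also have "T 1 = of_bool (w = 2) * z 3 + of_bool (w = 3) * z 2"
      by (auto simp: T_def pair_lo_def pair_hi_def)
    finally show ?thesis by (simp only: sum.distrib add.assoc)
  qed
  have hi: "(\<Sum>m\<in>{2..<k}. of_bool (m = w) * z (parent m)) = (if 2 \<le> w \<and> w < k then z (parent w) else 0)" for w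
    by (simp add: of_bool_def if_distrib[of "\<lambda>x. x * _"] cong: if_cong)
  have lo1: "(\<Sum>m\<in>{2..<k}. of_bool (parent m = 1) * z m) = (\<Sum>m\<in>{2,3,4,5}. z m)"
    using k by (intro sum.mono_neutral_cong_right) (auto simp: parent_def split: if_splits)
  have lo23: "(\<Sum>m\<in>{2..<k}. of_bool (parent m = w) * z m) = 0" if "w \<in> {2, 3}" for w
    using that by (intro sum.neutral) (auto simp: parent_def)
  have lo4: "(\<Sum>m\<in>{2..<k}. of_bool (parent m = w) * z m) = z (w + 2)" if "4 \<le> w" for w
  proof -
    have "(\<Sum>m\<in>{2..<k}. of_bool (parent m = w) * z m) = (\<Sum>m\<in>{2..<k} \<inter> {w + 2}. z m)"
      using that by (intro sum.mono_neutral_cong_right) (auto simp: parent_def split: if_splits)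
    also have "\<dots> = z (w + 2)" using support by (cases "w + 2 < k") auto
    finally show ?thesis .
  qed
  show "nbr 1 = z 2 + z 3 + z 4 + z 5" using gen[of 1] hi[of 1] lo1 by simp
  show "nbr 2 = z 1 + z 3" using gen[of 2] hi[of 2] lo23[of 2] k by (simp add: parent_def)
  show "nbr 3 = z 1 + z 2" using gen[of 3] hi[of 3] lo23[of 3] k by (simp add: parent_def)
  show "nbr w = z (parent w) + z (w + 2)" if "4 \<le> w" "w < k" for w
    using gen[of w] hi[of w] lo4[of w] that by simp
qed

lemma partial_pos_rank: "0 < w \<Longrightarrow> partial w = z 0 * nbr w"
  by (simp add: partial_def)

lemma partial_0: "partial 0 = pair_sum z"
proof -
  have "pair_lo m \<noteq> 0 \<and> pair_hi m \<noteq> 0" if "m \<in> {0<..<k}" for m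
    using that parent_pos[of m] by (auto simp: pair_lo_def pair_hi_def)
  then have "nbr 0 = 0" unfolding nbr_def by (intro sum.neutral) fastforce
  then show ?thesis by (simp add: partial_def)
qed

lemma tie_nbr_eq:
  assumes "0 < u" "u < k" "0 < v" "v < k" "u \<noteq> v" and "z u = z v"
  shows "nbr u = nbr v"
  using tie_partial_eq[of u v] assms pos[of 0] k by (simp add: partial_pos_rank)

lemma le: "i \<le> j \<Longrightarrow> z j \<le> z i" using decseqD[OF decreasing] .

lemma gap_1: "z 1 < z 0"
proof (rule ccontr)
  assume "\<not> z 1 < z 0"
  then have eq: "z 0 = z 1" using le[of 0 1] by simp
  then have "pair_sum z = z 0 * nbr 1"
    using tie_partial_eq[of 0 1] k by (simp add: partial_0 partial_pos_rank)
  moreover have "(\<Sum>m\<in>{1,2,3,4,5}. z (pair_lo m) * z (pair_hi m)) \<le> pair_sum z"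
    using k nonneg by (intro sum_mono2) auto
  moreover have "z 2 * z 3 > 0" using pos k by simp
  ultimately show False
    by (simp add: nbr_eq(1)[simplified] pair_lo_def pair_hi_def parent_def eq algebra_simps)
qed

lemma gap_2: "z 2 < z 1"
proof (rule ccontr)
  assume "\<not> z 2 < z 1"
  then have eq: "z 1 = z 2" using le[of 1 2] by simp
  then have "nbr 1 = nbr 2" using tie_nbr_eq[of 1 2] k by simp
  then show False using eq nbr_eq(1,2) pos[of 4] pos[of 5] k by simp
qed

text \<open>A tie at \<open>3\<close> and \<open>4\<close> forces \<open>z 6 = z 2\<close>, hence \<open>nbr 6 = nbr 2\<close>, hence \<open>z 8 = z 1\<close>, against \<open>z 2 < z 1\<close>.\<close>

lemma gap_4: "z 4 < z 3"
proof (rule ccontr)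
  assume "\<not> z 4 < z 3"
  then have eq: "z 3 = z 4" using le[of 3 4] by simp
  then have "nbr 3 = nbr 4" using tie_nbr_eq[of 3 4] k by simp
  then have 26: "z 2 = z 6" using nbr_eq(3) nbr_eq(4)[of 4] k by (simp add: parent_def)
  then have "6 < k" using support[of 6] pos[of 2] k by (cases "6 < k") auto
  then have "nbr 2 = nbr 6" using tie_nbr_eq[of 2 6] 26 by simp
  then have "z 8 = z 1" using eq nbr_eq(2) nbr_eq(4)[of 6] \<open>6 < k\<close> by (simp add: parent_def)
  then show False using gap_2 le[of 2 8] by simp
qed

text \<open>For \<open>s \<ge> 6\<close> the ranks \<open>s - 1\<close> and \<open>s\<close> lie on different arms, the latter one step farther from the
  centre. A tie between them makes their neighbour sums equal, and then their parents tie as well, so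
  the strict drop at \<open>s - 2\<close> carries over to \<open>s\<close>. For \<open>s = 6\<close> the parents are \<open>1\<close> and \<open>4\<close>.\<close>

lemma gap_even: "even s \<Longrightarrow> 4 \<le> s \<Longrightarrow> s < k \<Longrightarrow> z s < z (s - 1)"
proof (induction s rule: less_induct)
  case (less s)
  show ?case
  proof (cases "s = 4")
    case True then show ?thesis using gap_4 by simp
  next
    case False
    then have s: "s \<ge> 6" using less.prems by (auto elim!: evenE)
    show ?thesis
    proof (rule ccontr)
      assume "\<not> z s < z (s - 1)"
      then have "z (s - 1) = z s" using le[of "s - 1" s] by simp
      then have "nbr (s - 1) = nbr s" using tie_nbr_eq[of "s - 1" s] s less.prems by simp
      then have eq: "z (parent (s - 1)) + z (s + 1) = z (parent s) + z (s + 2)"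
        using nbr_eq(4)[of "s - 1"] nbr_eq(4)[of s] s less.prems by (simp add: eval_nat_numeral)
      have "z (parent s) < z (parent (s - 1))"
      proof (cases "s = 6")
        case True
        then show ?thesis using gap_2 le[of 2 4] by (simp add: parent_def)
      next
        case False
        then have "s \<ge> 8" using s less.prems by (auto elim!: evenE)
        moreover have "z (s - 2) < z (s - 2 - 1)" using less \<open>s \<ge> 8\<close> by (intro less.IH) auto
        moreover have "parent s = s - 2" "parent (s - 1) = s - 2 - 1"
          using \<open>s \<ge> 8\<close> by (auto simp: parent_def)
        ultimately show ?thesis by simp
      qed
      then show False using eq le[of "s + 1" "s + 2"] by simp
    qed
  qed
qed

lemma gap:
  assumes "s = 1 \<or> s = 2 \<or> (even s \<and> 4 \<le> s \<and> s < k) \<or> s = k"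
  shows "z s < z (s - 1)"
  using assms gap_1 gap_2 gap_even[of s] support[of k] pos[of "k - 1"] k by auto

end

section \<open>Equal counts determine the hypergraph\<close>

text \<open>The edge of the hypergraph on ranks that is encoded by a pair of positive ranks.\<close>

definition with_rank_0 :: "nat \<times> nat \<Rightarrow> nat set" where "with_rank_0 q = {0, fst q, snd q}"

lemma image_fun_upd_edges:
  assumes E: "\<And>e. e \<in> E \<Longrightarrow> e \<subseteq> {..<s}" and \<pi>: "\<And>m. m < s \<Longrightarrow> \<pi>' m = \<pi> m"
  shows "(\<lambda>e. \<pi>' ` e) ` E = (\<lambda>e. \<pi> ` e) ` E"
  using assms by (intro image_cong refl) (auto simp: subset_iff intro!: image_cong)

lemma edges_ranked_Delta_subset: "e \<in> edges (ranked_Delta s) \<Longrightarrow> s \<ge> 6 \<Longrightarrow> e \<subseteq> {..<s}"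
  using ranked_Delta_uniform[of s] by (auto simp: uniform_hypergraph_def verts_ranked_Delta)

text \<open>The pairs left when rank \<open>0\<close> is removed from the edges of a Berge path in the case of equality. The
  sizes in \<open>counts\<close> are among those after which \<open>z\<close> drops strictly; \<open>sparse\<close> and \<open>degrees\<close> hold for all sets of
  ranks containing \<open>0\<close> and are \<open>card_edges_within_less\<close> and \<open>excess_le_double\<close> in terms of pairs.\<close>

locale extremal_pairs =
  fixes k :: nat and P :: "(nat \<times> nat) set"
  assumes k: "k \<ge> 6" and fin: "finite P"
    and ordered: "\<And>q. q \<in> P \<Longrightarrow> 0 < fst q \<and> fst q < snd q \<and> snd q < k"
    and counts: "\<And>s t. s = 2 \<or> even s \<and> 4 \<le> s \<and> s \<le> k \<or> s = k \<Longrightarrow>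
      even t \<and> 4 \<le> t \<and> t \<le> k \<or> t = k \<Longrightarrow> s \<le> t \<Longrightarrow>
      card {q \<in> P. fst q < s \<and> snd q < t} + card {q \<in> P. snd q < s} = Delta_count k s t"
    and sparse: "\<And>X. finite X \<Longrightarrow> 0 \<in> X \<Longrightarrow> card {q \<in> P. fst q \<in> X \<and> snd q \<in> X} < card X"
    and degrees: "\<And>X. finite X \<Longrightarrow> 0 \<in> X \<Longrightarrow>
      card {q \<in> P. fst q \<in> X} + card {q \<in> P. snd q \<in> X} \<le> 2 * card X"
begin

definition good :: "nat \<Rightarrow> bool" where "good s \<longleftrightarrow> even s \<and> 4 \<le> s \<and> s \<le> k \<or> s = k"

definition below :: "nat \<Rightarrow> (nat \<times> nat) set" where "below s = {q \<in> P. snd q < s}"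

definition cnt :: "nat \<Rightarrow> nat \<Rightarrow> nat" where "cnt s t = card {q \<in> P. fst q < s \<and> snd q < t}"

lemma finite_below [simp]: "finite (below s)" using fin by (simp add: below_def)

lemma below_k: "below k = P" using ordered by (auto simp: below_def)

lemma cnt_diag: "cnt s s = card (below s)"
  unfolding cnt_def below_def by (intro arg_cong[of _ _ card]) (use ordered in force)

lemma card_below:
  assumes "good s"
  shows "card (below s) = s - 1"
proof -
  have s: "4 \<le> s" "s \<le> k" using assms k by (auto simp: good_def)
  have "cnt s s + card (below s) = Delta_count k s s"
    using counts[of s s] assms by (simp add: good_def cnt_def below_def)
  also have "\<dots> = 2 * (s - 1)" using s k by (simp add: Delta_count_eq)
  finally show ?thesis by (simp add: cnt_diag)
qed

lemma cnt_eq: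
  assumes "good s" "good t" "s + 2 \<le> t"
  shows "cnt s t = s + 1"
proof -
  have s: "4 \<le> s" "t \<le> k" using assms k by (auto simp: good_def)
  have "cnt s t + card (below s) = Delta_count k s t"
    using counts[of s t] assms by (simp add: good_def cnt_def below_def)
  also have "\<dots> = 2 * s" using s k assms(3) by (simp add: Delta_count_eq) 
  finally show ?thesis using card_below[OF assms(1)] s by simp
qed

lemma below_6: "below 6 = {(1, 2), (1, 3), (2, 3), (1, 4), (1, 5)}"
proof -
  have good: "good 6" "good 4" using k by (auto simp: good_def)
  have "below 2 = {}" using ordered by (force simp: below_def)
  then have "card {q \<in> P. fst q < 2 \<and> snd q < 6} = Delta_count k 2 6"
    using counts[of 2 6] k unfolding below_def[symmetric] by simp
  then have "card {q \<in> P. fst q < 2 \<and> snd q < 6} = card {(1, 2), (1, 3), (1, 4), (1, 5::nat)}"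
    using k by (simp add: Delta_count_eq)
  moreover have "{q \<in> P. fst q < 2 \<and> snd q < 6} \<subseteq> {(1, 2), (1, 3), (1, 4), (1, 5::nat)}"
    using ordered by force
  ultimately have A: "{q \<in> P. fst q < 2 \<and> snd q < 6} = {(1, 2), (1, 3), (1, 4), (1, 5)}"
    by (intro card_subset_eq) auto
  have "below 4 \<subseteq> {(1, 2), (1, 3), (2, 3)}" using ordered by (force simp: below_def)
  then have "below 4 = {(1, 2), (1, 3), (2, 3)}"
    using card_below[OF good(2)] by (intro card_subset_eq) auto
  then have "{(1, 2), (1, 3), (2, 3), (1, 4), (1, 5)} \<subseteq> below 6"
    using A by (auto simp: below_def)
  then show ?thesis
    using card_below[OF good(1)] by (intro card_subset_eq[symmetric]) auto
qed

text \<open>Passing from \<open>s + 2\<close> to \<open>k\<close> does not increase the number of pairs that start below \<open>s\<close>: every such pair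
  ends below \<open>s + 2\<close> already.\<close>

lemma next_layer:
  assumes "good s" "s + 2 \<le> k" "q \<in> P" "fst q < s"
  shows "snd q < s + 2"
proof (cases "s + 2 = k")
  case True then show ?thesis using ordered[OF assms(3)] by simp
next
  case False
  then have "good (s + 2)" "good k" using assms by (auto simp: good_def)
  then have "cnt s (s + 2) = cnt s k" using cnt_eq[of s] assms by simp
  then have "{q \<in> P. fst q < s \<and> snd q < s + 2} = {q \<in> P. fst q < s \<and> snd q < k}"
    unfolding cnt_def by (intro card_subset_eq) (use assms(2) fin in auto)
  then show ?thesis using assms ordered by blast
qed

text \<open>By the counts exactly two pairs end in \<open>{s, s + 1}\<close>, and they start in \<open>{s - 2, s - 1}\<close>. If both ended in
  the same rank, then that rank and \<open>{..<s}\<close> would contain too many pairs; if both started in the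
  same rank \<open>u\<close>, which also has a lower neighbour, then \<open>u\<close> and \<open>{..<s - 2}\<close> would violate the degree
  bound.\<close>

lemma next_two:
  assumes s: "even s" "6 \<le> s" "s + 2 \<le> k"
    and lower: "\<And>u. u \<in> {s - 2, s - 1} \<Longrightarrow> \<exists>a. (a, u) \<in> P"
  obtains u w where "{u, w} = {s - 2, s - 1}" "below (s + 2) = below s \<union> {(u, s), (w, s + 1)}"
proof -
  have good: "good s" "good (s + 2)" "good (s - 2)" "good k"
    using s by (auto simp: good_def)
  have two: "s - 2 + 2 = s" using s by simp
  define N where "N = {q \<in> P. fst q < s \<and> s \<le> snd q \<and> snd q < s + 2}"
  have split: "below (s + 2) = below s \<union> {q \<in> P. s \<le> snd q \<and> snd q < s + 2}"
    by (auto simp: below_def)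
  have "{q \<in> P. fst q < s \<and> snd q < s + 2} = below s \<union> N"
    using ordered by (force simp: below_def N_def)
  moreover have disj: "below s \<inter> N = {}" and finN: "finite N"
    using fin by (auto simp: below_def N_def)
  ultimately have cN: "card N = 2"
    using cnt_eq[OF good(1,2)] card_below[OF good(1)] s by (simp add: cnt_def card_Un_disjoint)
  have "below s \<union> N = below (s + 2)"
  proof (rule card_subset_eq)
    show "card (below s \<union> N) = card (below (s + 2))"
      using cN disj finN card_below[OF good(1)] card_below[OF good(2)] s
      by (simp add: card_Un_disjoint)
    show "below s \<union> N \<subseteq> below (s + 2)" by (auto simp: below_def N_def)
  qed simp
  moreover obtain q r where N: "N = {q, r}" "q \<noteq> r" using cN by (meson card_2_iff)
  ultimately have below: "below (s + 2) = below s \<union> {q, r}" by simp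
  have mem: "x \<in> P" "s - 2 \<le> fst x" "fst x < s" "snd x = s \<or> snd x = s + 1" if "x \<in> {q, r}" for x
  proof -
    have x: "x \<in> P" "fst x < s" "s \<le> snd x" "snd x < s + 2" using that N(1) by (auto simp: N_def)
    then show "x \<in> P" "fst x < s" "snd x = s \<or> snd x = s + 1" by auto
    show "s - 2 \<le> fst x"
      using next_layer[OF good(3) _ x(1), unfolded two] x(3) s by (cases "fst x < s - 2") auto
  qed
  have snd: "snd q \<noteq> snd r"
  proof
    assume eq: "snd q = snd r"
    define X where "X = insert (snd q) {..<s}"
    have "card X = s + 1" using mem(4)[of q] by (auto simp: X_def)
    moreover have "card (below s \<union> N) \<le> card {x \<in> P. fst x \<in> X \<and> snd x \<in> X}"
    proof (intro card_mono)
      show "below s \<union> N \<subseteq> {x \<in> P. fst x \<in> X \<and> snd x \<in> X}"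
        using mem eq unfolding N(1) by (auto simp: below_def X_def dest: ordered)
    qed (use fin in simp)
    moreover have "card (below s \<union> N) = s + 1"
      using disj finN cN card_below[OF good(1)] s by (simp add: card_Un_disjoint)
    ultimately show False using sparse[of X] s by (simp add: X_def)
  qed
  have fst: "fst q \<noteq> fst r"
  proof
    assume eq: "fst q = fst r"
    define u where "u = fst q"
    have u: "u \<in> {s - 2, s - 1}" using mem[of q] by (auto simp: u_def)
    then obtain a where a: "(a, u) \<in> P" using lower by blast
    define X where "X = insert u {..<s - 2}"
    have cX: "card X = s - 1" using u s by (auto simp: X_def)
    have "card ({x \<in> P. fst x < s - 2 \<and> snd x < k} \<union> {q, r}) = cnt (s - 2) k + 2"
      unfolding cnt_def using fin mem[of q] mem[of r] N(2)
      by (subst card_Un_disjoint) auto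
    moreover have "card ({x \<in> P. fst x < s - 2 \<and> snd x < k} \<union> {q, r}) \<le> card {x \<in> P. fst x \<in> X}"
      using mem eq fin by (intro card_mono) (auto simp: X_def u_def)
    moreover have "card (insert (a, u) (below (s - 2))) \<le> card {x \<in> P. snd x \<in> X}"
      using a fin by (intro card_mono) (auto simp: X_def below_def)
    moreover have "card (insert (a, u) (below (s - 2))) = Suc (card (below (s - 2)))"
      using u by (subst card_insert_disjoint[OF finite_below]) (auto simp: below_def)
    ultimately have "cnt (s - 2) k + 2 + Suc (card (below (s - 2))) \<le> 2 * card X"
      using degrees[of X] s by (simp add: X_def)
    then show False
      using cX cnt_eq[OF good(3,4), unfolded two] card_below[OF good(3)] s by linarith
  qed
  have fsts: "{fst q, fst r} = {s - 2, s - 1}"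
  proof -
    have "fst q = s - 2 \<or> fst q = s - 1" "fst r = s - 2 \<or> fst r = s - 1"
      using mem(2,3)[of q] mem(2,3)[of r] by auto
    then show ?thesis using fst by (metis insert_commute)
  qed
  have "\<exists>u w. {u, w} = {s - 2, s - 1} \<and> {q, r} = {(u, s), (w, s + 1)}"
  proof (cases "snd q = s")
    case True
    then obtain a b where "q = (a, s)" "r = (b, s + 1)"
      using snd mem(4)[of r] by (cases q; cases r) auto
    then show ?thesis using fsts by (intro exI[of _ a] exI[of _ b]) simp
  next
    case False
    then obtain a b where "q = (a, s + 1)" "r = (b, s)"
      using snd mem(4)[of q] mem(4)[of r] by (cases q; cases r) auto
    then show ?thesis using fsts by (intro exI[of _ b] exI[of _ a]) (simp add: insert_commute)
  qed
  then show ?thesis using that below by metis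
qed

lemma lower_exists:
  assumes "even s" "6 \<le> s" "s \<le> k"
  shows "\<forall>u\<in>{s - 2, s - 1}. \<exists>a. (a, u) \<in> P"
  using assms
proof (induction s rule: less_induct)
  case (less s)
  show ?case
  proof (cases "s = 6")
    case True
    have "(1, 4) \<in> below 6" "(1, 5) \<in> below 6" by (simp_all add: below_6)
    then show ?thesis using True by (auto simp: below_def)
  next
    case False
    then have s: "8 \<le> s" using less.prems by (auto elim!: evenE)
    define r where "r = s - 2"
    have r: "r < s" "even r" "6 \<le> r" "r + 2 \<le> k" "s - 2 = r" "s - 1 = r + 1"
      using less.prems s by (auto simp: r_def)
    have "\<forall>u\<in>{r - 2, r - 1}. \<exists>a. (a, u) \<in> P" using r by (intro less.IH) auto
    then obtain u w where "below (r + 2) = below r \<union> {(u, r), (w, r + 1)}"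
      using next_two[OF r(2-4)] by metis
    then have "(u, r) \<in> below (r + 2)" "(w, r + 1) \<in> below (r + 2)" by simp_all
    then have "(u, s - 2) \<in> P" "(w, s - 1) \<in> P" unfolding r(5,6) by (simp_all add: below_def)
    then show ?thesis by blast
  qed
qed

text \<open>The ranks \<open>s - 2\<close> and \<open>s - 1\<close> may be tied, so the arms of \<open>ranked_Delta s\<close> can be attached in either order.
  The freedom to prescribe the image \<open>u\<close> of \<open>s - 2\<close> is what makes the induction work: the two
  new pairs dictate which of the two ends has to be continued by which new rank.\<close>

lemma prefix_iso:
  assumes "even s" "6 \<le> s" "s \<le> k" "u \<in> {s - 2, s - 1}"
  shows "\<exists>\<pi>. bij_betw \<pi> {..<s} {..<s} \<and> \<pi> 0 = 0 \<and> \<pi> (s - 2) = u \<and> {\<pi> (s - 2), \<pi> (s - 1)} = {s - 2, s - 1}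
    \<and> (\<lambda>e. \<pi> ` e) ` edges (ranked_Delta s) = with_rank_0 ` below s"
  using assms
proof (induction s arbitrary: u rule: less_induct)
  case (less s)
  show ?case
  proof (cases "s = 6")
    case True
    define \<pi> where "\<pi> m = (if m = 4 then u else if m = 5 then 9 - u else m)" for m
    have u: "u = 4 \<or> u = 5" using less.prems True by auto
    have six: "{..<6::nat} = {0, 1, 2, 3, 4, 5}" and two_six: "{2..<6::nat} = {2, 3, 4, 5}" by auto
    have "bij_betw \<pi> {..<6} {..<6}"
      using u unfolding six bij_betw_def by (auto simp: \<pi>_def)
    moreover have "\<pi> 0 = 0" "\<pi> 4 = u" "{\<pi> 4, \<pi> 5} = {4, 5}" using u by (auto simp: \<pi>_def)
    moreover have "(\<lambda>e. \<pi> ` e) ` edges (ranked_Delta 6) = with_rank_0 ` below 6"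
    proof -
      have "edges (ranked_Delta 6) = {{0, 2, 3}, {0, 1, 2}, {0, 1, 3}, {0, 1, 4}, {0, 1, 5}}"
        by (simp add: ranked_Delta_def two_six parent_def)
      moreover have "{{0, 1, \<pi> 4}, {0, 1, \<pi> 5}} = {{0, 1, 4}, {0, 1, 5}}"
        using u by (auto simp: \<pi>_def)
      ultimately show ?thesis by (auto simp: below_6 with_rank_0_def \<pi>_def)
    qed
    ultimately show ?thesis unfolding True by (intro exI[of _ \<pi>]) simp
  next
    case False
    then have s8: "8 \<le> s" using less.prems by (auto elim!: evenE)
    define r where "r = s - 2"
    have r: "even r" "6 \<le> r" "r + 2 \<le> k" "r < s" "s = r + 2" using less.prems s8 by (auto simp: r_def)
    obtain u0 u1 where par: "{u0, u1} = {r - 2, r - 1}"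
      and below: "below (r + 2) = below r \<union> {(u0, r), (u1, r + 1)}"
      using next_two[OF r(1-3)] lower_exists[OF r(1,2)] r(3) by auto
    have u: "u = r \<or> u = r + 1" using less.prems(4) r by auto
    define a where "a = (if u = r then u0 else u1)"
    have "a \<in> {r - 2, r - 1}" using par by (auto simp: a_def)
    then obtain \<pi> where \<pi>: "bij_betw \<pi> {..<r} {..<r}" "\<pi> 0 = 0" "\<pi> (r - 2) = a"
      "{\<pi> (r - 2), \<pi> (r - 1)} = {r - 2, r - 1}"
      "(\<lambda>e. \<pi> ` e) ` edges (ranked_Delta r) = with_rank_0 ` below r"
      using less.IH[OF r(4,1,2), of a] r(3) by auto
    have new: "{(u0, r), (u1, r + 1)} = {(\<pi> (r - 2), u), (\<pi> (r - 1), 2 * r + 1 - u)}"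
      using par \<pi>(3,4) u by (auto simp: a_def doubleton_eq_iff)
    define \<pi>' where "\<pi>' = \<pi>(r := u, r + 1 := 2 * r + 1 - u)"
    have same: "\<pi>' m = \<pi> m" if "m < r" for m using that by (simp add: \<pi>'_def)
    have bij: "bij_betw \<pi>' ({..<r} \<union> {r, r + 1}) ({..<r} \<union> {r, r + 1})"
    proof (rule bij_betw_combine)
      show "bij_betw \<pi>' {..<r} {..<r}" using \<pi>(1) by (subst bij_betw_cong[of _ \<pi>' \<pi>]) (simp_all add: same)
      show "bij_betw \<pi>' {r, r + 1} {r, r + 1}"
        using u by (auto simp: \<pi>'_def bij_betw_def)
    qed auto
    have dom: "{..<r} \<union> {r, r + 1} = {..<r + 2}" by auto
    have "edges (ranked_Delta (r + 2)) =
        edges (ranked_Delta r) \<union> {{0, r - 2, r}, {0, r - 1, r + 1}}"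
    proof -
      have "{2..<r + 2} = {2..<r} \<union> {r, r + 1}" using r by auto
      then show ?thesis using r by (auto simp: ranked_Delta_def parent_def)
    qed
    then have "(\<lambda>e. \<pi>' ` e) ` edges (ranked_Delta (r + 2)) =
        with_rank_0 ` below r \<union> {\<pi>' ` {0, r - 2, r}, \<pi>' ` {0, r - 1, r + 1}}"
      using image_fun_upd_edges[of "edges (ranked_Delta r)" r \<pi>' \<pi>] same
        edges_ranked_Delta_subset[OF _ r(2)] \<pi>(5) by (simp add: image_Un)
    also have "{\<pi>' ` {0, r - 2, r}, \<pi>' ` {0, r - 1, r + 1}} = with_rank_0 ` {(u0, r), (u1, r + 1)}"
      unfolding new using r \<pi>(2) by (simp add: with_rank_0_def \<pi>'_def)
    also have "with_rank_0 ` below r \<union> with_rank_0 ` {(u0, r), (u1, r + 1)} = with_rank_0 ` below (r + 2)"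
      unfolding below by (simp add: image_Un)
    finally have "(\<lambda>e. \<pi>' ` e) ` edges (ranked_Delta (r + 2)) = with_rank_0 ` below (r + 2)" .
    moreover note bij[unfolded dom]
    moreover have "\<pi>' 0 = 0" using \<pi>(2) r same by simp
    moreover have "\<pi>' r = u" "{\<pi>' r, \<pi>' (r + 1)} = {r, r + 1}" using u by (auto simp: \<pi>'_def)
    ultimately show ?thesis unfolding \<open>s = r + 2\<close> by (intro exI[of _ \<pi>']) simp
  qed
qed

text \<open>For odd \<open>k\<close> the last rank \<open>k - 1\<close> is left over; its only neighbour is one of the two ends of the arms,
  and \<open>prefix_iso\<close> can be arranged to put the longer arm there.\<close>

lemma ranked_Delta_iso: "hypergraph_iso (ranked_Delta k) (Hypergraph {..<k} (with_rank_0 ` P))"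
proof (cases "even k")
  case True
  then show ?thesis
    using prefix_iso[OF True k order_refl, of "k - 1"] below_k
    by (auto simp: hypergraph_iso_def verts_ranked_Delta)
next
  case False
  define s where "s = k - 1"
  have s: "even s" "6 \<le> s" "s + 1 = k" using False k by (auto simp: s_def elim!: oddE)
  have good: "good s" "good k" "good (s - 2)" using s by (auto simp: good_def)
  have two: "s - 2 + 2 = s" using s by simp
  have "card (P - below s) = 1"
    using card_below[OF good(1)] card_below[OF good(2)] below_k s
    by (subst card_Diff_subset[OF finite_below]) (auto simp: below_def)
  then obtain q where q: "P - below s = {q}" by (rule card_1_singletonE)
  then have "q \<in> P - below s" by simp
  then have mem: "q \<in> P" "snd q = s" using ordered[of q] s by (auto simp: below_def)
  have "s - 2 \<le> fst q"
    using next_layer[OF good(3) _ mem(1), unfolded two] mem(2) s by (cases "fst q < s - 2") auto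
  then have "fst q \<in> {s - 2, s - 1}" using ordered[OF mem(1)] mem(2) by auto
  then obtain \<pi> where \<pi>: "bij_betw \<pi> {..<s} {..<s}" "\<pi> 0 = 0" "\<pi> (s - 2) = fst q"
      "(\<lambda>e. \<pi> ` e) ` edges (ranked_Delta s) = with_rank_0 ` below s"
    using prefix_iso[OF s(1,2), of "fst q"] s(3) by auto
  define \<pi>' where "\<pi>' = \<pi>(s := s)"
  have same: "\<pi>' m = \<pi> m" if "m < s" for m using that by (simp add: \<pi>'_def)
  have bij: "bij_betw \<pi>' ({..<s} \<union> {s}) ({..<s} \<union> {s})"
  proof (rule bij_betw_combine)
    show "bij_betw \<pi>' {..<s} {..<s}" using \<pi>(1) by (subst bij_betw_cong[of _ \<pi>' \<pi>]) (simp_all add: same)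
  qed (auto simp: \<pi>'_def bij_betw_def)
  have dom: "{..<s} \<union> {s} = {..<k}" using s by auto
  have "edges (ranked_Delta k) = edges (ranked_Delta s) \<union> {{0, s - 2, s}}"
  proof -
    have "{2..<k} = {2..<s} \<union> {s}" using s by auto
    then show ?thesis using s by (auto simp: ranked_Delta_def parent_def)
  qed
  then have "(\<lambda>e. \<pi>' ` e) ` edges (ranked_Delta k) = with_rank_0 ` below s \<union> {\<pi>' ` {0, s - 2, s}}"
    using image_fun_upd_edges[of "edges (ranked_Delta s)" s \<pi>' \<pi>] same
      edges_ranked_Delta_subset[OF _ s(2)] \<pi>(4) by (simp add: image_Un)
  also have "\<pi>' ` {0, s - 2, s} = with_rank_0 q"
    using s \<pi>(2,3) mem(2) by (simp add: with_rank_0_def \<pi>'_def)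
  also have "with_rank_0 ` below s \<union> {with_rank_0 q} = with_rank_0 ` (below s \<union> {q})" by simp
  also have "below s \<union> {q} = P" using q by (auto simp: below_def)
  finally show ?thesis
    using bij[unfolded dom]
    by (auto simp: hypergraph_iso_def verts_ranked_Delta intro!: exI[of _ \<pi>'])
qed

end

lemma card_filter_image:
  assumes "inj_on f I"
  shows "card {q \<in> f ` I. R q} = card {i \<in> I. R (f i)}"
proof -
  have "{q \<in> f ` I. R q} = f ` {i \<in> I. R (f i)}" by auto
  then show ?thesis using card_image[OF inj_on_subset[OF assms, of "{i \<in> I. R (f i)}"]] by simp
qed

lemma (in ranked_berge_path) extremal_pairs_of_equal_counts:
  assumes lo: "\<And>i. i < k - 1 \<Longrightarrow> lo i = 0" and hi: "\<And>i. i < k - 1 \<Longrightarrow> hi i < k"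
    and counts: "\<And>s t. s = 2 \<or> even s \<and> 4 \<le> s \<and> s \<le> k \<or> s = k \<Longrightarrow>
      even t \<and> 4 \<le> t \<and> t \<le> k \<or> t = k \<Longrightarrow> s \<le> t \<Longrightarrow> path_count s t = Delta_count k s t"
  shows "extremal_pairs k ((\<lambda>i. (mid i, hi i)) ` {..<k - 1})"
    and "e ` {..<k - 1} = with_rank_0 ` (\<lambda>i. (mid i, hi i)) ` {..<k - 1}"
proof -
  define f where "f i = (mid i, hi i)" for i
  define I where "I = {..<k - 1}"
  have inj: "inj_on f I"
  proof (rule inj_onI)
    fix i j assume ij: "i \<in> I" "j \<in> I" "f i = f j"
    then have "e i = e j" using edge lo by (simp add: f_def I_def)
    then show "i = j" using inj_onD[OF berge_pathD(2)[OF path]] ij by (simp add: I_def)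
  qed
  have card: "card {q \<in> f ` I. R (fst q) (snd q)} = card {i \<in> I. R (mid i) (hi i)}" for R
    using card_filter_image[OF inj, of "\<lambda>q. R (fst q) (snd q)"] by (simp add: f_def)
  have finI: "finite I" by (simp add: I_def)
  have sum_card: "(\<Sum>i\<in>I. of_bool (R i)) = card {i \<in> I. R i}" for R
    using finI by (simp add: Collect_conj_eq)
  have "extremal_pairs k (f ` I)"
  proof
    fix s t assume st: "s = 2 \<or> even s \<and> 4 \<le> s \<and> s \<le> k \<or> s = k"
      "even t \<and> 4 \<le> t \<and> t \<le> k \<or> t = k" "s \<le> t"
    have "path_count s t = (\<Sum>i\<in>I. of_bool (mid i < s \<and> hi i < t) + of_bool (hi i < s))"
      unfolding pair_count_def I_def
    proof (intro sum.cong refl)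
      fix i assume "i \<in> {..<k - 1}"
      then have "(hi i < s \<and> mid i < t) = (hi i < s)" using order[of i] st(3) by auto
      then show "of_bool (mid i < s \<and> hi i < t) + of_bool (hi i < s \<and> mid i < t)
          = (of_bool (mid i < s \<and> hi i < t) + of_bool (hi i < s) :: nat)" by simp
    qed
    then show "card {q \<in> f ` I. fst q < s \<and> snd q < t} + card {q \<in> f ` I. snd q < s} = Delta_count k s t"
      using counts[OF st] card[of "\<lambda>a b. a < s \<and> b < t"] card[of "\<lambda>a b. b < s"]
      by (simp only: sum.distrib sum_card)
  next
    fix X :: "nat set" assume X: "finite X" "0 \<in> X"
    have "{i \<in> I. mid i \<in> X \<and> hi i \<in> X} = {i. i < k - 1 \<and> e i \<subseteq> X}"
      using edge lo X(2) by (auto simp: I_def)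
    then show "card {q \<in> f ` I. fst q \<in> X \<and> snd q \<in> X} < card X"
      using card[of "\<lambda>a b. a \<in> X \<and> b \<in> X"] card_edges_within_less[OF path X(1)] X(2) by auto
    have "card (e i \<inter> X) - 1 = of_bool (mid i \<in> X) + of_bool (hi i \<in> X)" if "i \<in> I" for i
      using that edge[of i] order[of i] lo[of i] X(2) by (auto simp: I_def Int_insert_left)
    then have "excess k e X UNIV = (\<Sum>i\<in>I. of_bool (mid i \<in> X) + of_bool (hi i \<in> X))"
      unfolding excess_def by (intro sum.cong) (auto simp: I_def)
    then show "card {q \<in> f ` I. fst q \<in> X} + card {q \<in> f ` I. snd q \<in> X} \<le> 2 * card X"
      using card[of "\<lambda>a b. a \<in> X"] card[of "\<lambda>a b. b \<in> X"] excess_le_double[OF path X(1), of UNIV]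
      by (simp only: sum.distrib sum_card)
  qed (use k finI order hi lo in \<open>auto simp: f_def I_def\<close>)
  then show "extremal_pairs k ((\<lambda>i. (mid i, hi i)) ` {..<k - 1})" by (simp add: f_def I_def)
  show "e ` {..<k - 1} = with_rank_0 ` (\<lambda>i. (mid i, hi i)) ` {..<k - 1}"
    unfolding image_image with_rank_0_def
    using edge lo by (intro image_cong) auto
qed

section \<open>The bound and its equality case\<close>

theorem theorem1p1:
  fixes p :: real and k :: nat and H :: "'a hypergraph"
  assumes "p \<ge> 1" and "k \<ge> 6"
    and "uniform_hypergraph 3 H" and "no_isolated_vertices H"
    and "is_berge (path_graph k) H"
  shows "p_spectral_radius 3 p H \<le> p_spectral_radius 3 p (suspension (Delta1 k)) \<and>
    (p > 2 \<longrightarrow>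
      (p_spectral_radius 3 p H = p_spectral_radius 3 p (suspension (Delta1 k)) \<longleftrightarrow>
       hypergraph_iso H (suspension (Delta1 k))))"
proof -
  note p = assms(1) and k = assms(2) and H = assms(3)
  have HV: "finite (verts H)" "\<And>e. e \<in> edges H \<Longrightarrow> e \<subseteq> verts H"
    using H by (auto simp: uniform_hypergraph_def)
  define D where "D = ranked_Delta k"
  have D: "uniform_hypergraph 3 D" "verts D = {..<k}" "verts D \<noteq> {}"
    using ranked_Delta_uniform[OF k] k by (auto simp: D_def verts_ranked_Delta lessThan_empty_iff)
  have iso_D: "hypergraph_iso (suspension (Delta1 k)) D"
    using suspension_Delta1_iso_ranked_Delta[OF k] by (simp add: D_def)
  have susp: "\<And>e. e \<in> edges (suspension (Delta1 k)) \<Longrightarrow> e \<subseteq> verts (suspension (Delta1 k))"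
    using suspension_uniform[OF Delta1_uniform] by (simp add: uniform_hypergraph_def)
  have radius_D: "p_spectral_radius 3 p (suspension (Delta1 k)) = p_spectral_radius 3 p D"
    by (rule p_spectral_radius_iso[OF iso_D susp])
  obtain v e where path: "berge_path k v e" and E: "edges H = e ` {..<k - 1}"
    and v: "v ` {..<k} \<subseteq> verts H"
    by (rule is_berge_path_graph[OF assms(5) H])
  define n where "n = card (verts H)"
  have kn: "k \<le> n"
    using card_inj_on_le[OF berge_pathD(1)[OF path] v HV(1)] by (simp add: n_def)
  then have ne: "verts H \<noteq> {}" using k by (auto simp: n_def)
  obtain \<rho> and z :: "nat \<Rightarrow> real" where \<rho>: "bij_betw \<rho> (verts H) {..<n}"
    and z: "decseq z" "\<And>m. z m \<ge> 0" "\<And>m. m \<ge> n \<Longrightarrow> z m = 0" "(\<Sum>m<n. z m powr p) = 1"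
    and form_H: "edge_form 3 H (z \<circ> \<rho>) = p_spectral_radius 3 p H"
    using ranked_maximizer[OF H ne p] unfolding n_def by metis
  define e' where "e' i = \<rho> ` e i" for i
  have eV: "e i \<subseteq> verts H" if "i < k - 1" for i using HV(2) E that by simp
  have path': "berge_path k (\<rho> \<circ> v) e'"
    unfolding e'_def
    by (rule berge_path_image[OF path bij_betw_imp_inj_on[OF \<rho>] eV]) (use k in simp_all)
  obtain lo mid hi where "ranked_berge_path k (\<rho> \<circ> v) e' lo mid hi"
    using exists_ranked_berge_path[OF k path'] by blast
  then interpret R: ranked_berge_path k "\<rho> \<circ> v" e' lo mid hi .
  have form_H': "p_spectral_radius 3 p H = 3 * (\<Sum>i<k - 1. \<Prod>m\<in>e' i. z m)"
  proof -
    have "(\<Sum>f\<in>edges H. \<Prod>v\<in>f. z (\<rho> v)) = (\<Sum>i<k - 1. \<Prod>v\<in>e i. z (\<rho> v))"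
      unfolding E sum.reindex[OF berge_pathD(2)[OF path]] o_def ..
    also have "\<dots> = (\<Sum>i<k - 1. \<Prod>m\<in>e' i. z m)"
      unfolding e'_def using inj_on_subset[OF bij_betw_imp_inj_on[OF \<rho>] eV]
      by (intro sum.cong refl) (simp add: prod.reindex)
    finally show ?thesis using form_H by (simp add: edge_form_def)
  qed
  have sum_k: "(\<Sum>m<k. z m powr p) \<le> 1"
    unfolding z(4)[symmetric] using kn by (intro sum_mono2) auto
  have "p_spectral_radius 3 p H \<le> edge_form 3 D z"
    unfolding form_H' D_def edge_form_ranked_Delta[OF k]
    by (intro mult_left_mono R.path_sum_le_Delta[OF z(1-3)]) auto
  moreover have form_D: "edge_form 3 D z \<le> p_spectral_radius 3 p D"
    using sum_k z(2) D(2) by (intro edge_form_le_p_spectral_radius[OF D(1,3) _ p]) auto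
  ultimately have le: "p_spectral_radius 3 p H \<le> p_spectral_radius 3 p D" by simp
  have "hypergraph_iso H D" if p2: "p > 2" and eq: "p_spectral_radius 3 p H = p_spectral_radius 3 p D"
  proof -
    have max_D: "edge_form 3 D z = p_spectral_radius 3 p D"
      using \<open>p_spectral_radius 3 p H \<le> edge_form 3 D z\<close> form_D eq by simp
    \<comment> \<open>By maximality \<open>z\<close> puts no weight on ranks \<open>\<ge> k\<close>: otherwise rescaling its restriction to
      norm \<open>1\<close> would exceed the maximum.\<close>
    define s where "s = (\<Sum>m<k. z m powr p)"
    have s0: "s \<ge> 0" by (simp add: s_def sum_nonneg)
    have radius_pos: "p_spectral_radius 3 p D > 0"
      unfolding D_def by (rule p_spectral_radius_ranked_Delta_pos[OF k p])
    have "p_spectral_radius 3 p D \<le> p_spectral_radius 3 p D * (s powr (1 / p)) ^ 3"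
      using edge_form_le_scaled[OF D(1) _ p, of z] max_D z(2) D(2) by (simp add: s_def)
    then have "1 \<le> (s powr (1 / p)) ^ 3" using radius_pos by simp
    then have "\<not> s powr (1 / p) < 1" using power_strict_mono[of "s powr (1 / p)" 1 3] by auto
    moreover have "s powr (1 / p) < 1 powr (1 / p)" if "s < 1"
      using that s0 p by (intro powr_less_mono2) auto
    ultimately have s1: "s = 1" using sum_k by (fastforce simp: s_def)
    have z_k: "z m = 0" if "m \<ge> k" for m
    proof (cases "m < n")
      case True
      have "(\<Sum>m<n. z m powr p) = s + (\<Sum>m\<in>{k..<n}. z m powr p)"
        unfolding s_def using kn by (simp add: sum.atLeastLessThan_concat lessThan_atLeast0)
      then have "(\<Sum>m\<in>{k..<n}. z m powr p) = 0" using z(4) s1 by simp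
      then show ?thesis using True that by (subst (asm) sum_nonneg_eq_0_iff) auto
    qed (simp add: z(3))
    interpret Z: Delta_maximizer k p z
      using k p2 z(1,2) z_k s1 max_D by unfold_locales (simp_all add: s_def D_def)
    have path_eq: "(\<Sum>i<k - 1. \<Prod>m\<in>e' i. z m) = z 0 * (\<Sum>m\<in>{0<..<k}. z (pair_lo m) * z (pair_hi m))"
      using eq form_H' Z.maximal' by (simp add: D_def)
    have "z 0 > 0" using Z.pos k by simp
    note eqD = R.path_sum_eqD[where n = n, OF z(1-3) path_eq this]
    have counts: "R.path_count s t = Delta_count k s t"
      if "s = 2 \<or> even s \<and> 4 \<le> s \<and> s \<le> k \<or> s = k" "even t \<and> 4 \<le> t \<and> t \<le> k \<or> t = k" "s \<le> t" for s t
    proof (rule eqD(1))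
      have "z s < z (s - 1)" if "s = 2 \<or> even s \<and> 4 \<le> s \<and> s \<le> k \<or> s = k" for s
        using that by (intro Z.gap) auto
      then show "z s < z (s - 1)" "z t < z (t - 1)" using that by blast+
    qed (use that k in auto)
    \<comment> \<open>The counts at \<open>s = t = k\<close> say that all \<open>k - 1\<close> edges lie inside the first \<open>k\<close> ranks.\<close>
    have hi: "hi i < k" if i: "i < k - 1" for i
    proof (rule ccontr)
      assume hi: "\<not> hi i < k"
      have "R.path_count k k = (\<Sum>i<k - 1. 2 * of_bool (hi i < k))"
        unfolding pair_count_def
      proof (intro sum.cong refl)
        fix i assume "i \<in> {..<k - 1}"
        then have "mid i < hi i" using R.order by simp
        then show "of_bool (mid i < k \<and> hi i < k) + of_bool (hi i < k \<and> mid i < k)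
            = (2 * of_bool (hi i < k) :: nat)" by auto
      qed
      also have "\<dots> < (\<Sum>i<k - 1. 2)" using i hi by (intro sum_strict_mono_ex1) auto
      finally show False using counts[of k k] k by (simp add: Delta_count_eq)
    qed
    \<comment> \<open>Since \<open>z 0\<close> is strictly largest, replacing the heaviest vertex of an edge by rank \<open>0\<close>
      loses nothing only if that vertex already has rank \<open>0\<close>.\<close>
    have lo: "lo i = 0" if i: "i < k - 1" for i
    proof -
      have "z (lo i) = z 0"
        using i Z.pos hi[OF i] R.order[OF i] by (intro eqD(2)) auto
      then show ?thesis
        using Z.gap_1 Z.le[of 1 "lo i"] by (cases "lo i = 0") auto
    qed
    \<comment> \<open>Without isolated vertices, \<open>H\<close> has no vertices beyond those of its edges.\<close>
    have "\<rho> ` verts H \<subseteq> {..<k}"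
    proof clarify
      fix w assume "w \<in> verts H"
      then obtain f where "f \<in> edges H" "w \<in> f"
        using assms(4) by (auto simp: no_isolated_vertices_def)
      then obtain i where i: "i < k - 1" "\<rho> w \<in> e' i" by (auto simp: E e'_def)
      then show "\<rho> w < k"
        using R.edge[OF i(1)] R.order[OF i(1)] hi[OF i(1)] by auto
    qed
    then have nk: "n = k" using \<rho> kn by (auto simp: bij_betw_def)
    define P where "P = (\<lambda>i. (mid i, hi i)) ` {..<k - 1}"
    have P: "extremal_pairs k P" "e' ` {..<k - 1} = with_rank_0 ` P"
      unfolding P_def by (rule R.extremal_pairs_of_equal_counts[OF lo hi counts]; assumption)+
    have "hypergraph_iso D (Hypergraph {..<k} (e' ` {..<k - 1}))"
      unfolding P(2) D_def by (rule extremal_pairs.ranked_Delta_iso[OF P(1)])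
    then have "hypergraph_iso (Hypergraph {..<k} (e' ` {..<k - 1})) D"
      by (rule hypergraph_iso_sym) (use D(1) in \<open>simp add: uniform_hypergraph_def\<close>)
    moreover have "hypergraph_iso H (Hypergraph {..<k} (e' ` {..<k - 1}))"
      unfolding hypergraph_iso_def E using \<rho> nk
      by (intro exI[of _ \<rho>]) (auto simp: e'_def image_image)
    ultimately show ?thesis by (rule hypergraph_iso_trans[rotated])
  qed
  moreover have "hypergraph_iso D (suspension (Delta1 k))" by (rule hypergraph_iso_sym[OF iso_D susp])
  ultimately have "hypergraph_iso H (suspension (Delta1 k))"
    if "p > 2" "p_spectral_radius 3 p H = p_spectral_radius 3 p D"
    using that hypergraph_iso_trans by blast
  moreover have "p_spectral_radius 3 p H = p_spectral_radius 3 p D"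
    if "hypergraph_iso H (suspension (Delta1 k))"
    using p_spectral_radius_iso[OF that HV(2)] radius_D by simp
  ultimately show ?thesis using le radius_D by auto
qed

end
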